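(* Let $f\in\mathcal{S}_H^0(\frac12\mathbb{Z})$, i.e. $f\in\mathcal{S}_H^0$ with half-integer coefficients. If $f$ is convex in the direction of the imaginary axis, then $f$ is one of the eleven functions from $\mathcal{T}_5\cup\mathcal{T}_6$, where $$\mathcal{T}_5=\left\{z,\ \frac{z}{1+z},\ \frac{z}{1-z},\ \frac{z}{1-z^2},\ \frac{z(2+z)}{2(1+z)},\ \frac{z(2-z)}{2(1-z)},\ \frac{z(2-z^2)}{2(1-z^2)},\ \frac{z(2+z)}{2(1-z^2)},\ \frac{z(2-z)}{2(1-z^2)}\right\}$$ and $$\mathcal{T}_6=\left\{\mathrm{Re}\left(\frac{z}{1-z}\right)+i\,\mathrm{Im}\left(\frac{z}{(1-z)^2}\right),\ \mathrm{Re}\left(\frac{z}{1+z}\right)+i\,\mathrm{Im}\left(\frac{z}{(1+z)^2}\right)\right\}.$$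
   Context: Let $\mathbb{D}=\{z\in\mathbb{C}:|z|<1\}$. A complex-valued harmonic function on $\mathbb{D}$ can be written $f=h+\overline{g}$ with $h,g$ analytic in $\mathbb{D}$. It is univalent if it is injective on $\mathbb{D}$, and sense-preserving if $J_f(z)=|h'(z)|^2-|g'(z)|^2>0$ for all $z\in\mathbb{D}$. $\mathcal{S}_H$ denotes the class of all univalent sense-preserving harmonic functions $f=h+\overline{g}$ on $\mathbb{D}$ with $h(z)=z+\sum_{n=2}^{\infty}a_nz^n$ and $g(z)=\sum_{n=1}^{\infty}b_nz^n$, and $\mathcal{S}_H^0=\{f\in\mathcal{S}_H: f_{\bar z}(0)=0\}$, i.e. those with $b_1=g'(0)=0$. $f$ has half-integer coefficients if $2a_n\in\mathbb{Z}$ and $2b_n\in\mathbb{Z}$ for all $n$ (so integers are allowed as coefficients); $\mathcal{S}_H^0(\frac12\mathbb{Z})$ denotes the set of $f\in\mathcal{S}_H^0$ with half-integer coefficients. A univalent harmonic function $f$ in $\mathbb{D}$ is convex in the direction of the imaginary axis (convex in imaginary direction) if every line parallel to the imaginary axis has a connected (possibly empty) intersection with $f(\mathbb{D})$. *)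

theory Defs
  imports "HOL-Complex_Analysis.Complex_Analysis"
begin

abbreviation unit_disc :: "complex set" where
  "unit_disc \<equiv> ball 0 1"

text \<open>
  Functions on the disc are total functions \<^typ>\<open>complex \<Rightarrow> complex\<close> of which only the values on
  the disc matter. The condition on \<open>g 0\<close> (no constant term in \<open>g\<close>) makes \<open>h\<close> and \<open>g\<close> unique
  on the disc, so it is immaterial whether properties of the pair below are stated existentially
  or universally.
\<close>

definition canonical_rep ::
    "(complex \<Rightarrow> complex) \<Rightarrow> (complex \<Rightarrow> complex) \<Rightarrow> (complex \<Rightarrow> complex) \<Rightarrow> bool" where
  "canonical_rep f h g \<longleftrightarrow>
     h holomorphic_on unit_disc \<and> g holomorphic_on unit_disc \<and> g 0 = 0 \<and>
     (\<forall>z\<in>unit_disc. f z = h z + cnj (g z))"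

definition taylor_coeff :: "(complex \<Rightarrow> complex) \<Rightarrow> nat \<Rightarrow> complex" where
  "taylor_coeff h n = fps_nth (fps_expansion h 0) n"

definition jacobian :: "(complex \<Rightarrow> complex) \<Rightarrow> (complex \<Rightarrow> complex) \<Rightarrow> complex \<Rightarrow> real" where
  "jacobian h g z = (norm (deriv h z))\<^sup>2 - (norm (deriv g z))\<^sup>2"

definition S_H :: "(complex \<Rightarrow> complex) set" where
  "S_H = {f. inj_on f unit_disc \<and>
     (\<exists>h g. canonical_rep f h g \<and> taylor_coeff h 0 = 0 \<and> taylor_coeff h 1 = 1 \<and>
        (\<forall>z\<in>unit_disc. jacobian h g z > 0))}"

text \<open>
  For \<open>f = h + cnj g\<close>, the Wirtinger derivative of \<open>f\<close> at \<open>0\<close> with respect to the conjugate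
  variable is \<open>cnj (deriv g 0)\<close>.
\<close>

definition S_H0 :: "(complex \<Rightarrow> complex) set" where
  "S_H0 = {f \<in> S_H. \<exists>h g. canonical_rep f h g \<and> deriv g 0 = 0}"

definition half_integer_coeffs :: "(complex \<Rightarrow> complex) \<Rightarrow> bool" where
  "half_integer_coeffs f \<longleftrightarrow>
     (\<exists>h g. canonical_rep f h g \<and>
        (\<forall>n. 2 * taylor_coeff h n \<in> \<int> \<and> 2 * taylor_coeff g n \<in> \<int>))"

definition S_H0_half :: "(complex \<Rightarrow> complex) set" where
  "S_H0_half = {f \<in> S_H0. half_integer_coeffs f}"

definition convex_imaginary_direction :: "(complex \<Rightarrow> complex) \<Rightarrow> bool" where
  "convex_imaginary_direction f \<longleftrightarrow>
     (\<forall>x::real. connected ({w. Re w = x} \<inter> f ` unit_disc))"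

definition T5 :: "(complex \<Rightarrow> complex) set" where
  "T5 =
    {\<lambda>z. z,
     \<lambda>z. z / (1 + z),
     \<lambda>z. z / (1 - z),
     \<lambda>z. z / (1 - z\<^sup>2),
     \<lambda>z. z * (2 + z) / (2 * (1 + z)),
     \<lambda>z. z * (2 - z) / (2 * (1 - z)),
     \<lambda>z. z * (2 - z\<^sup>2) / (2 * (1 - z\<^sup>2)),
     \<lambda>z. z * (2 + z) / (2 * (1 - z\<^sup>2)),
     \<lambda>z. z * (2 - z) / (2 * (1 - z\<^sup>2))}"

definition T6 :: "(complex \<Rightarrow> complex) set" where
  "T6 =
    {\<lambda>z. complex_of_real (Re (z / (1 - z))) + \<i> * complex_of_real (Im (z / (1 - z)\<^sup>2)),
     \<lambda>z. complex_of_real (Re (z / (1 + z))) + \<i> * complex_of_real (Im (z / (1 + z)\<^sup>2))}"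

end

theory Submission
  imports Defs
begin

text \<open>
  For \<open>f = h + cnj g\<close> the holomorphic function \<open>F = h + g\<close> has the same real part as \<open>f\<close>. Following
  Clunie and Sheil-Small, \<open>F\<close> is again univalent with vertically convex image
  (\<open>shear_univalent_and_vertically_convex\<close>), and its coefficients are half-integers, in particular
  real. The proof determines \<open>F\<close> first and then the ways to split it into \<open>h\<close> and \<open>g\<close>.

  A domain that is symmetric about the real axis and vertically convex is Steiner symmetric, and its
  Green function decreases along vertical half lines away from the axis. This is seen by
  reflecting in horizontal lines and applying the maximum principle (\<open>moving_plane\<close>), which requires no
  information on the boundary behaviour of \<open>F\<close>. Translated to the disc, it says that \<open>z F'\<close> is
  typically real (\<open>typically_real_of_vertically_convex\<close>), so \<open>(1 - z\<^sup>2) F'\<close> has nonnegative real part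
  and its coefficients form a positive semidefinite Toeplitz sequence
  (\<open>psd_toeplitz_of_typically_real\<close>).

  The coefficients of \<open>(1 - z\<^sup>2) F'\<close> are bounded by 2, whereas a change of \<open>c\<^sub>n\<close> by \<open>1/2\<close> moves the
  corresponding one by \<open>n / 2\<close>. Hence half-integer coefficients of \<open>F\<close> are eventually 2-periodic, and
  the few possible beginnings are sorted out with the Toeplitz form
  (\<open>half_integer_toeplitz_classification\<close>). The outcome is that \<open>F\<close> is one of the nine functions in
  \<open>T5\<close>.

  A similar play of size against integrality restricts the dilatation \<open>g' / h'\<close>: if the first
  nonzero coefficient of \<open>g\<close> has index \<open>n\<close>, then this function bounded by 1 has a coefficient of
  modulus at least \<open>n / 2\<close>. So either \<open>g = 0\<close>, or the Schwarz lemma forces \<open>g' = \<plusminus> z h'\<close> (\<open>half_integer_dilatation\<close>). In the second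
  case divisibility by 3 and 4 in the coefficient recursion leaves only \<open>F = z / (1 \<plusminus> z)\<close>, and
  integrating gives \<open>T6\<close>.
\<close>

section \<open>Positive semidefinite Toeplitz sequences\<close>

text \<open>
  On natural numbers one of the truncated differences \<open>j - k\<close> and \<open>k - j\<close> vanishes, so their sum
  is the distance \<open>\<bar>j - k\<bar>\<close>.
\<close>

definition psd_toeplitz :: "(nat \<Rightarrow> real) \<Rightarrow> bool" where
  "psd_toeplitz t \<longleftrightarrow>
     (\<forall>N x. 0 \<le> (\<Sum>j<N. \<Sum>k<N. x j * x k * t ((j - k) + (k - j))))"

lemma psd_toeplitz_list:
  assumes "psd_toeplitz t"
  shows "0 \<le> (\<Sum>j<length xs. \<Sum>k<length xs. xs ! j * xs ! k * t ((j - k) + (k - j)))"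
  using assms unfolding psd_toeplitz_def by blast

text \<open>
  Every use of positivity for indices of unknown size needs a test vector supported on at most
  three of them.
\<close>

lemma psd_toeplitz_three:
  assumes psd: "psd_toeplitz t" and ij: "i < j" and jk: "j < k"
  shows "0 \<le> (a\<^sup>2 + b\<^sup>2 + c\<^sup>2) * t 0 + 2 * a * b * t (j - i) + 2 * a * c * t (k - i)
              + 2 * b * c * t (k - j)"
proof -
  define x where "x = (\<lambda>n. if n = i then a else if n = j then b else if n = k then c else 0)"
  define d where "d = (\<lambda>p q::nat. (p - q) + (q - p))"
  have supp: "(\<Sum>n<Suc k. x n * g n) = x i * g i + x j * g j + x k * g k" for g
  proof -
    have "(\<Sum>n<Suc k. x n * g n) = (\<Sum>n\<in>{i,j,k}. x n * g n)"
      by (rule sum.mono_neutral_right) (use ij jk in \<open>auto simp: x_def\<close>)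
    thus ?thesis using ij jk by simp
  qed
  have "0 \<le> (\<Sum>p<Suc k. \<Sum>q<Suc k. x p * x q * t (d p q))"
    using psd unfolding psd_toeplitz_def d_def by blast
  also have "\<dots> = (\<Sum>p<Suc k. x p * (\<Sum>q<Suc k. x q * t (d p q)))"
    by (simp add: sum_distrib_left mult.assoc del: sum.lessThan_Suc)
  also have "\<dots> = x i * (x i * t (d i i) + x j * t (d i j) + x k * t (d i k))
      + x j * (x i * t (d j i) + x j * t (d j j) + x k * t (d j k))
      + x k * (x i * t (d k i) + x j * t (d k j) + x k * t (d k k))"
    by (simp only: supp)
  also have "\<dots> = (a\<^sup>2 + b\<^sup>2 + c\<^sup>2) * t 0 + 2 * a * b * t (j - i) + 2 * a * c * t (k - i)
              + 2 * b * c * t (k - j)"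
    using ij jk by (simp add: x_def d_def algebra_simps power2_eq_square)
  finally show ?thesis .
qed

lemma psd_toeplitz_bound:
  assumes psd: "psd_toeplitz t"
  shows "\<bar>t n\<bar> \<le> t 0"
proof (cases "n = 0")
  case True
  have "0 \<le> t 0" using psd_toeplitz_list[OF psd, of "[1]"] by simp
  thus ?thesis using True by simp
next
  case False
  have "0 \<le> 2 * t 0 + 2 * t n" "0 \<le> 2 * t 0 - 2 * t n"
    using psd_toeplitz_three[OF psd, of 0 n "Suc n" 1 1 0]
      psd_toeplitz_three[OF psd, of 0 n "Suc n" 1 "-1" 0] False by simp_all
  thus ?thesis by simp
qed

lemma nonneg_quadratic_zero_slope:
  fixes a d :: real
  assumes "\<And>x. 0 \<le> x\<^sup>2 * a + 2 * x * d"
  shows "d = 0"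
proof (rule ccontr)
  assume d: "d \<noteq> 0"
  define M where "M = \<bar>a\<bar> + 1"
  have M: "M > 0" "a < M" by (auto simp: M_def)
  have "0 \<le> (- d / M)\<^sup>2 * a + 2 * (- d / M) * d" by (rule assms)
  also have "\<dots> = (d\<^sup>2 / M\<^sup>2) * (a - 2 * M)" using M by (simp add: field_simps power2_eq_square)
  also have "\<dots> < 0" using d M by (intro mult_pos_neg) auto
  finally show False by simp
qed

text \<open>
  When \<open>t m\<close> attains its bound, the vector \<open>e\<^sub>n - \<sigma> e\<^sub>n\<^sub>+\<^sub>m\<close> is a null vector of the form, hence lies
  in its kernel, and pairing it with \<open>e\<^sub>0\<close> compares \<open>t n\<close> with \<open>t (n + m)\<close>. For \<open>n \<le> m\<close> the same
  is done with the null vector \<open>e\<^sub>0 - \<sigma> e\<^sub>m\<close> paired with \<open>e\<^sub>n\<close>.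
\<close>

lemma psd_toeplitz_extremal:
  assumes psd: "psd_toeplitz t" and m: "m > 0" and \<sigma>: "\<bar>\<sigma>\<bar> = 1" and ext: "t m = \<sigma> * t 0"
  shows "t (n + m) = \<sigma> * t n" and "n \<le> m \<Longrightarrow> t (m - n) = \<sigma> * t n"
proof -
  have \<sigma>2: "\<sigma> * \<sigma> = 1" using \<sigma> by (cases "\<sigma> \<ge> 0") auto
  have \<sigma>2': "\<sigma> * (\<sigma> * y) = y" for y using \<sigma>2 by (simp add: mult.assoc[symmetric])
  show "t (n + m) = \<sigma> * t n"
  proof (cases "n = 0")
    case False
    have "0 \<le> a\<^sup>2 * t 0 + 2 * a * (t n - \<sigma> * t (n + m))" for a
      using psd_toeplitz_three[OF psd, of 0 n "n + m" a 1 "-\<sigma>"] False m ext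
      by (simp add: algebra_simps power2_eq_square \<sigma>2 \<sigma>2')
    from nonneg_quadratic_zero_slope[OF this] show ?thesis using \<sigma>2' by (metis eq_iff_diff_eq_0)
  qed (use ext in simp)
  show "t (m - n) = \<sigma> * t n" if "n \<le> m"
  proof (cases "n = 0 \<or> n = m")
    case False
    have "0 \<le> a\<^sup>2 * t 0 + 2 * a * (t n - \<sigma> * t (m - n))" for a
      using psd_toeplitz_three[OF psd, of 0 n m 1 a "-\<sigma>"] False that ext
      by (simp add: algebra_simps power2_eq_square \<sigma>2 \<sigma>2')
    from nonneg_quadratic_zero_slope[OF this] show ?thesis using \<sigma>2' by (metis eq_iff_diff_eq_0)
  qed (use ext \<sigma>2' in auto)
qed

lemma psd_toeplitz_scale:
  assumes "psd_toeplitz t" "c \<ge> 0"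
  shows "psd_toeplitz (\<lambda>n. c * t n)"
  unfolding psd_toeplitz_def
proof (intro allI)
  fix N x
  have "0 \<le> c * (\<Sum>j<N. \<Sum>k<N. x j * x k * t ((j - k) + (k - j)))"
    using assms by (simp add: psd_toeplitz_def)
  also have "\<dots> = (\<Sum>j<N. \<Sum>k<N. x j * x k * (c * t ((j - k) + (k - j))))"
    by (simp add: sum_distrib_left mult_ac)
  finally show "0 \<le> (\<Sum>j<N. \<Sum>k<N. x j * x k * (c * t ((j - k) + (k - j))))" .
qed

lemma psd_toeplitz_limit:
  assumes "\<And>n. ((\<lambda>r. t r n) \<longlongrightarrow> T n) F" "F \<noteq> bot" "eventually (\<lambda>r. psd_toeplitz (t r)) F"
  shows "psd_toeplitz T"
  unfolding psd_toeplitz_def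
proof (intro allI)
  fix N x
  show "0 \<le> (\<Sum>j<N. \<Sum>k<N. x j * x k * T ((j - k) + (k - j)))"
  proof (rule tendsto_lowerbound)
    show "((\<lambda>r. \<Sum>j<N. \<Sum>k<N. x j * x k * t r ((j - k) + (k - j))) \<longlongrightarrow>
       (\<Sum>j<N. \<Sum>k<N. x j * x k * T ((j - k) + (k - j)))) F"
      by (intro tendsto_intros assms)
    show "\<forall>\<^sub>F r in F. 0 \<le> (\<Sum>j<N. \<Sum>k<N. x j * x k * t r ((j - k) + (k - j)))"
      using assms(3) by eventually_elim (simp add: psd_toeplitz_def)
  qed (rule assms)
qed

section \<open>Toeplitz positivity from nonnegative real parts\<close>

text \<open>
  The Fourier coefficients of \<open>P\<close> on the unit circle: those of nonnegative index are Taylor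
  coefficients by the Cauchy integral formula, the others vanish by the theorem of Cauchy.
\<close>

lemma circle_moment:
  fixes P :: "complex \<Rightarrow> complex"
  assumes hol: "P holomorphic_on ball 0 R" and R: "R > 1"
  defines "e \<equiv> \<lambda>t. exp (2 * of_real pi * \<i> * of_real t)"
  shows "((\<lambda>t. P (e t) * (e t ^ j * cnj (e t) ^ k)) has_integral
           (if j \<le> k then fps_nth (fps_expansion P 0) (k - j) else 0)) {0..1}"
proof -
  have sub: "cball 0 1 \<subseteq> ball (0::complex) R" using R by auto
  have hol1: "P holomorphic_on cball 0 1" using hol sub by (rule holomorphic_on_subset)
  have [simp]: "e t \<noteq> 0" for t by (simp add: e_def)
  have cnj_e: "cnj (e t) = 1 / e t" for t
    by (simp add: e_def exp_cnj exp_minus[symmetric] divide_inverse)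
  have path: "((\<lambda>t. f (e t) * e t) has_integral (I / (2 * of_real pi * \<i>))) {0..1}"
    if "(f has_contour_integral I) (circlepath 0 1)" for f I
  proof -
    have "((\<lambda>t. f (e t) * (2 * of_real pi * \<i> * e t)) has_integral I) {0..1}"
      using that unfolding has_contour_integral_def
      by (rule has_integral_eq[rotated])
         (simp_all add: vector_derivative_circlepath01, simp add: e_def circlepath)
    from has_integral_mult_right[OF this, of "1 / (2 * of_real pi * \<i>)"]
    show ?thesis by (simp add: field_simps)
  qed
  show ?thesis
  proof (cases "j \<le> k")
    case True
    have "((\<lambda>u. P u / (u - 0) ^ Suc (k - j)) has_contour_integral
        (2 * pi * \<i>) / fact (k - j) * (deriv ^^ (k - j)) P 0) (circlepath 0 1)"
      by (rule Cauchy_has_contour_integral_higher_derivative_circlepath)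
         (use hol1 in \<open>auto intro: holomorphic_on_imp_continuous_on holomorphic_on_subset\<close>)
    from path[OF this] have "((\<lambda>t. P (e t) / e t ^ (k - j)) has_integral
        fps_nth (fps_expansion P 0) (k - j)) {0..1}"
      by (simp add: fps_expansion_def field_simps)
    moreover have "P (e t) * (e t ^ j * cnj (e t) ^ k) = P (e t) / e t ^ (k - j)" for t
      using True by (simp add: cnj_e power_diff field_simps)
    ultimately show ?thesis using True by simp
  next
    case False
    have "((\<lambda>u. P u * u ^ (j - k - 1)) has_contour_integral 0) (circlepath 0 1)"
      by (rule Cauchy_theorem_convex_simple[where S = "cball 0 1"])
         (use hol1 in \<open>auto intro!: holomorphic_intros\<close>)
    from path[OF this] have "((\<lambda>t. P (e t) * e t ^ (j - k - 1) * e t) has_integral 0) {0..1}"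
      by simp
    moreover have "P (e t) * (e t ^ j * cnj (e t) ^ k) = P (e t) * e t ^ (j - k - 1) * e t" for t
    proof -
      have "j = Suc (j - k - 1) + k" using False by simp
      hence "e t ^ j = e t ^ (j - k - 1) * e t * e t ^ k"
        by (metis power_Suc2 power_add)
      thus ?thesis by (simp add: cnj_e power_one_over)
    qed
    ultimately show ?thesis using False by (simp only: if_False)
  qed
qed

text \<open>
  The Toeplitz form of the vector \<open>x\<close> is twice the mean of the nonnegative function
  \<open>Re P \<cdot> \<bar>\<Sum>\<^sub>j x\<^sub>j z\<^sup>j\<bar>\<^sup>2\<close> over the unit circle. The constant coefficient is doubled because
  it contributes both to \<open>P\<close> and to its conjugate. This is one half of the theorem of Caratheodory
  and Toeplitz.
\<close>

lemma psd_toeplitz_of_nonneg_Re: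
  fixes P :: "complex \<Rightarrow> complex"
  assumes hol: "P holomorphic_on ball 0 R" and R: "R > 1"
    and Re_nonneg: "\<And>z. norm z = 1 \<Longrightarrow> 0 \<le> Re (P z)"
  shows "psd_toeplitz (\<lambda>n. (if n = 0 then 2 else 1) * Re (fps_nth (fps_expansion P 0) n))"
  unfolding psd_toeplitz_def
proof (intro allI)
  fix N :: nat and x :: "nat \<Rightarrow> real"
  define e where "e = (\<lambda>t. exp (2 * of_real pi * \<i> * of_real t))"
  define p where "p = (\<lambda>n. Re (fps_nth (fps_expansion P 0) n))"
  define I where "I = (\<lambda>j k. if j \<le> k then fps_nth (fps_expansion P 0) (k - j) else 0)"
  define X where "X = (\<lambda>t. \<Sum>j<N. of_real (x j) * e t ^ j)"
  have "((\<lambda>t. \<Sum>j<N. \<Sum>k<N. of_real (x j * x k) * (P (e t) * (e t ^ j * cnj (e t) ^ k)))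
      has_integral (\<Sum>j<N. \<Sum>k<N. of_real (x j * x k) * I j k)) {0..1}"
    unfolding I_def e_def
    by (intro has_integral_sum has_integral_mult_right circle_moment[OF hol R]) auto
  moreover have "(\<Sum>j<N. \<Sum>k<N. of_real (x j * x k) * (P (e t) * (e t ^ j * cnj (e t) ^ k)))
      = P (e t) * of_real ((norm (X t))\<^sup>2)" for t
  proof -
    have "of_real ((norm (X t))\<^sup>2) = X t * cnj (X t)" by (rule complex_norm_square)
    also have "\<dots> = (\<Sum>j<N. \<Sum>k<N. of_real (x j * x k) * (e t ^ j * cnj (e t) ^ k))"
      by (simp add: X_def sum_product mult_ac)
    finally show ?thesis by (simp add: sum_distrib_left mult_ac)
  qed
  ultimately have "((\<lambda>t. P (e t) * of_real ((norm (X t))\<^sup>2)) has_integral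
      (\<Sum>j<N. \<Sum>k<N. of_real (x j * x k) * I j k)) {0..1}" by simp
  hence "((\<lambda>t. Re (P (e t) * of_real ((norm (X t))\<^sup>2))) has_integral
      Re (\<Sum>j<N. \<Sum>k<N. of_real (x j * x k) * I j k)) {0..1}" by (rule has_integral_Re)
  moreover have "0 \<le> Re (P (e t) * of_real ((norm (X t))\<^sup>2))" for t
    using Re_nonneg[of "e t"] by (simp add: e_def)
  ultimately have "0 \<le> Re (\<Sum>j<N. \<Sum>k<N. of_real (x j * x k) * I j k)"
    by (rule has_integral_nonneg)
  also have "\<dots> = (\<Sum>j<N. \<Sum>k<N. x j * x k * Re (I j k))" by simp
  finally have nonneg: "0 \<le> (\<Sum>j<N. \<Sum>k<N. x j * x k * Re (I j k))" .
  \<comment> \<open>The integrals \<open>I j k\<close> vanish below the diagonal; symmetrizing restores the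
    Toeplitz form.\<close>
  have "(\<Sum>j<N. \<Sum>k<N. x j * x k * Re (I j k)) = (\<Sum>j<N. \<Sum>k<N. x j * x k * Re (I k j))"
    by (subst sum.swap) (simp add: mult_ac)
  hence "2 * (\<Sum>j<N. \<Sum>k<N. x j * x k * Re (I j k)) =
      (\<Sum>j<N. \<Sum>k<N. x j * x k * (Re (I j k) + Re (I k j)))"
    by (simp add: sum.distrib distrib_left)
  also have "\<dots> = (\<Sum>j<N. \<Sum>k<N. x j * x k *
      ((if (j - k) + (k - j) = 0 then 2 else 1) * p ((j - k) + (k - j))))"
    by (intro sum.cong refl arg_cong2[where f = "(*)"]) (auto simp: I_def p_def)
  finally show "0 \<le> (\<Sum>j<N. \<Sum>k<N. x j * x k *
      ((if (j - k) + (k - j) = 0 then 2 else 1) * Re (fps_nth (fps_expansion P 0) ((j - k) + (k - j)))))"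
    using nonneg unfolding p_def by linarith
qed

text \<open>
  If \<open>T = z F'\<close> is typically real, then \<open>Re ((1 - z\<^sup>2) F')\<close> is nonnegative: on the unit circle
  \<open>(1 - z\<^sup>2) / z = -2 \<i> Im z\<close>, so the real part of \<open>(1 - z\<^sup>2) T / z\<close> is \<open>2 Im z \<cdot> Im T\<close>. As \<open>F'\<close>
  need not extend to the circle, the factor \<open>1 - z\<^sup>2\<close> is multiplied with the dilate \<open>F' (r z)\<close>, and
  only the finitely many coefficients in each Toeplitz form are taken to the limit \<open>r \<rightarrow> 1\<close>. The
  sequence \<open>e\<close> lists the coefficients of \<open>(1 - z\<^sup>2) F'\<close>, with the constant term doubled.
\<close>

lemma psd_toeplitz_of_typically_real:
  assumes hol: "F holomorphic_on unit_disc"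
    and tr: "\<And>z. z \<in> unit_disc \<Longrightarrow> 0 \<le> Im z * Im (z * deriv F z)"
  defines "c \<equiv> (\<lambda>n. Re (fps_nth (fps_expansion F 0) n))"
  assumes e0: "e 0 = 2 * c 1"
    and e_Suc: "\<And>n. e (Suc n) = real (n + 2) * c (n + 2) - real n * c n"
  shows "psd_toeplitz e"
proof -
  define C where "C = fps_expansion F 0"
  define Q where "Q = (\<lambda>r. (1 - fps_X ^ 2) * (fps_deriv C oo (fps_const (complex_of_real r) * fps_X)))"
  define t where "t = (\<lambda>r n. (if n = 0 then 2 else 1) * Re (fps_nth (Q r) n))"
  have FC: "F has_fps_expansion C" unfolding C_def using hol by (intro has_fps_expansion_fps_expansion) auto
  have comp: "fps_nth (fps_deriv C oo (fps_const (complex_of_real r) * fps_X)) n = of_real (real (n + 1) * r ^ n) * fps_nth C (n + 1)" for r n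
    by (simp add: fps_nth_compose_linear)
  have "psd_toeplitz (t r)" if r: "r \<in> {0<..<1}" for r
  proof -
    define P where "P = (\<lambda>z. (1 - z\<^sup>2) * deriv F (of_real r * z))"
    have maps: "of_real r * z \<in> unit_disc" if "z \<in> ball 0 (1 / r)" for z
      using that r by (simp add: norm_mult field_simps)
    have "deriv F holomorphic_on unit_disc" using hol by (intro holomorphic_deriv) auto
    hence "deriv F \<circ> (\<lambda>z. of_real r * z) holomorphic_on ball 0 (1 / r)"
      by (rule holomorphic_on_compose_gen[rotated]) (use maps in \<open>auto intro!: holomorphic_intros\<close>)
    hence holP: "P holomorphic_on ball 0 (1 / r)" unfolding P_def o_def by (intro holomorphic_intros)
    have "deriv F has_fps_expansion fps_deriv C" using FC by (rule has_fps_expansion_deriv)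
    moreover have "(\<lambda>z. complex_of_real r * z) has_fps_expansion fps_const (complex_of_real r) * fps_X"
      using has_fps_expansion_cmult_left[OF has_fps_expansion_fps_X] .
    ultimately have "(deriv F \<circ> (\<lambda>z. complex_of_real r * z)) has_fps_expansion
        (fps_deriv C oo (fps_const (complex_of_real r) * fps_X))"
      by (rule has_fps_expansion_compose) simp
    moreover have "(\<lambda>z::complex. 1 - z ^ 2) has_fps_expansion 1 - fps_X ^ 2"
      by (intro has_fps_expansion_diff has_fps_expansion_1 has_fps_expansion_fps_X_power)
    ultimately have "P has_fps_expansion Q r" unfolding P_def Q_def o_def
      by (intro has_fps_expansion_mult)
    hence QP: "fps_expansion P 0 = Q r" by (rule fps_expansion_eqI)
    have "0 \<le> Re (P z)" if z: "norm z = 1" for z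
    proof -
      have 1: "1 = z * cnj z" using z by (simp add: complex_norm_square[symmetric])
      have "(1 - z\<^sup>2) = z * (cnj z - z)" by (subst 1) (simp add: algebra_simps power2_eq_square)
      also have "cnj z - z = -2 * \<i> * of_real (Im z)" by (simp add: complex_eq_iff)
      finally have eq: "1 - z\<^sup>2 = z * (-2 * \<i> * of_real (Im z))" .
      define w where "w = of_real r * z * deriv F (of_real r * z)"
      have "P z = -2 * \<i> * of_real (Im z / r) * w"
        unfolding P_def eq w_def using r by (simp add: mult_ac)
      hence "Re (P z) = 2 * (Im z / r) * Im w" by simp
      also have "\<dots> = 2 / r\<^sup>2 * (Im (of_real r * z) * Im w)"
        using r by (simp add: power2_eq_square)
      also have "\<dots> \<ge> 0"
        unfolding w_def by (rule mult_nonneg_nonneg[OF _ tr]) (use r z in \<open>simp_all add: norm_mult\<close>)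
      finally show ?thesis .
    qed
    from psd_toeplitz_of_nonneg_Re[OF holP _ this] r show ?thesis by (simp add: QP t_def)
  qed
  moreover have "eventually (\<lambda>r::real. r \<in> {0<..<1}) (at_left 1)"
    by (intro eventually_at_left_real) auto
  ultimately have ev: "eventually (\<lambda>r. psd_toeplitz (t r)) (at_left 1)" by (auto elim: eventually_mono)
  show ?thesis
  proof (rule psd_toeplitz_limit[OF _ _ ev])
    fix n
    show "((\<lambda>r. t r n) \<longlongrightarrow> e n) (at_left 1)"
    proof (cases n)
      case 0
      show ?thesis unfolding t_def Q_def
        by (simp add: 0 e0 c_def C_def comp)
    next
      case (Suc m)
      have "t r n = real (m + 2) * r ^ (m + 1) * c (m + 2) - real m * r ^ (m - 1) * c m" for r
        unfolding t_def Q_def Suc by (simp add: left_diff_distrib fps_X_power_mult_nth comp c_def C_def)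
      moreover have "((\<lambda>r. real (m + 2) * r ^ (m + 1) * c (m + 2) - real m * r ^ (m - 1) * c m) \<longlongrightarrow>
          real (m + 2) * 1 ^ (m + 1) * c (m + 2) - real m * 1 ^ (m - 1) * c m) (at_left 1)"
        by (intro tendsto_intros)
      ultimately show ?thesis using Suc e_Suc[of m] by simp
    qed
  qed simp
qed

section \<open>Vertical convexity under the shear\<close>

lemma connected_on_vertical_line:
  assumes conn: "connected ({w. Re w = x} \<inter> A)"
    and a: "Complex x a \<in> A" and b: "Complex x b \<in> A" and y: "a \<le> y" "y \<le> b"
  shows "Complex x y \<in> A"
proof -
  have "connected (Im ` ({w. Re w = x} \<inter> A))"
    using conn by (intro connected_continuous_image continuous_intros)
  moreover have "a \<in> Im ` ({w. Re w = x} \<inter> A)" "b \<in> Im ` ({w. Re w = x} \<inter> A)"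
    using a b by force+
  ultimately have "y \<in> Im ` ({w. Re w = x} \<inter> A)" using y by (rule connectedD_interval)
  thus ?thesis by (auto simp: complex_eq_iff elim!: subst[of _ _ "\<lambda>w. w \<in> A", rotated])
qed

text \<open>
  Local injectivity makes \<open>\<psi>\<close> an open map, and an open continuous map of an interval into the
  line is injective.
\<close>

lemma locally_injective_imp_injective_real:
  fixes \<psi> :: "real \<Rightarrow> real"
  assumes cont: "continuous_on S \<psi>" and S: "is_interval S" "open S"
    and loc: "\<And>y. y \<in> S \<Longrightarrow> \<exists>\<epsilon>>0. ball y \<epsilon> \<subseteq> S \<and> inj_on \<psi> (ball y \<epsilon>)"
  shows "inj_on \<psi> S"
proof -
  have "open (\<psi> ` T)" if T: "open T" "T \<subseteq> S" for T
  proof (subst open_subopen, intro ballI)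
    fix v assume "v \<in> \<psi> ` T"
    then obtain y where y: "y \<in> T" "v = \<psi> y" by blast
    with T loc obtain \<epsilon> where \<epsilon>: "\<epsilon> > 0" "ball y \<epsilon> \<subseteq> S" "inj_on \<psi> (ball y \<epsilon>)" by blast
    have "open (\<psi> ` (ball y \<epsilon> \<inter> T))"
      using \<epsilon> T by (intro invariance_of_domain continuous_on_subset[OF cont])
        (auto intro: inj_on_subset)
    thus "\<exists>T'. open T' \<and> v \<in> T' \<and> T' \<subseteq> \<psi> ` T"
      using y \<epsilon>(1) by (intro exI[of _ "\<psi> ` (ball y \<epsilon> \<inter> T)"]) auto
  qed
  thus ?thesis using injective_eq_1d_open_map_UNIV[OF cont S(1)] by blast
qed

text \<open>
  One direction of the shear construction of Clunie and Sheil-Small. Since \<open>F\<close> and \<open>f\<close> have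
  the same real part, \<open>F \<circ> f\<^sup>-\<^sup>1\<close> maps every vertical line into itself. On such a line it is a
  locally injective function \<open>\<psi>\<close> of one real variable, defined on an interval because \<open>f\<close> has a
  vertically convex image. Hence \<open>\<psi>\<close> is injective and its range is an interval, which yields the
  two claims line by line.
\<close>

lemma shear_univalent_and_vertically_convex:
  fixes f F :: "complex \<Rightarrow> complex"
  assumes D: "open D" and contf: "continuous_on D f" and injf: "inj_on f D"
    and conv: "\<And>x. connected ({w. Re w = x} \<inter> f ` D)"
    and holF: "F holomorphic_on D" and F': "\<And>z. z \<in> D \<Longrightarrow> deriv F z \<noteq> 0"
    and Re_eq: "\<And>z. z \<in> D \<Longrightarrow> Re (F z) = Re (f z)"
  shows "inj_on F D" and "connected ({w. Re w = x} \<inter> F ` D)"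
proof -
  \<comment> \<open>\<open>Y x\<close> is the trace of the image of \<open>f\<close> on the vertical line through \<open>x\<close>, and
    \<open>c x\<close> lifts it to \<open>D\<close>.\<close>
  define Y where "Y = (\<lambda>x. {y. Complex x y \<in> f ` D})"
  define c where "c = (\<lambda>x y. inv_into D f (Complex x y))"
  define \<psi> where "\<psi> = (\<lambda>x y. Im (F (c x y)))"
  have openfD: "open (f ` D)" using contf D injf by (rule invariance_of_domain)
  have cont_inv: "continuous_on (f ` D) (inv_into D f)"
    using invariance_of_domain[OF continuous_on_subset[OF contf] _ inj_on_subset[OF injf]] D injf
    by (intro continuous_on_inverse_open_map[OF contf refl]) (auto simp: openin_open_eq openfD)
  have c: "c x y \<in> D" "f (c x y) = Complex x y" if "y \<in> Y x" for x y
    using that unfolding Y_def c_def by (auto intro: inv_into_into f_inv_into_f)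
  have contC: "continuous_on A (\<lambda>y. Complex x y)" for x A
    unfolding Complex_eq by (intro continuous_intros)
  have contc: "continuous_on (Y x) (c x)" for x
    unfolding c_def by (rule continuous_on_compose2[OF cont_inv contC]) (auto simp: Y_def)
  have contFc: "continuous_on (Y x) (\<lambda>y. F (c x y))" for x
    using continuous_on_compose2[OF holomorphic_on_imp_continuous_on[OF holF] contc] c by blast
  have cont\<psi>: "continuous_on (Y x) (\<psi> x)" for x
    unfolding \<psi>_def by (intro continuous_intros contFc)
  have openY: "open (Y x)" for x
  proof -
    have "Y x = (\<lambda>y. Complex x y) -` (f ` D)" by (auto simp: Y_def)
    thus ?thesis using openfD contC[of UNIV] by (simp add: open_vimage)
  qed
  have intY: "is_interval (Y x)" for x
    unfolding is_interval_1 Y_def using connected_on_vertical_line[OF conv] by blast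
  have Fc: "F (c x y) = Complex x (\<psi> x y)" if "y \<in> Y x" for x y
    using Re_eq[of "c x y"] c[OF that] by (simp add: \<psi>_def complex_eq_iff)
  have inj\<psi>: "inj_on (\<psi> x) (Y x)" for x
  proof (rule locally_injective_imp_injective_real[OF cont\<psi> intY openY])
    fix y assume y: "y \<in> Y x"
    obtain r where r: "r > 0" "ball (c x y) r \<subseteq> D" "inj_on F (ball (c x y) r)"
      using has_complex_derivative_locally_injective[OF holF c(1)[OF y] D F'] c[OF y] by blast
    have "open (Y x \<inter> c x -` ball (c x y) r)"
      using contc openY by (intro continuous_open_preimage) auto
    then obtain \<epsilon> where \<epsilon>: "\<epsilon> > 0" "ball y \<epsilon> \<subseteq> Y x \<inter> c x -` ball (c x y) r"
      using y r(1) by (auto simp: open_contains_ball) (metis Int_iff centre_in_ball vimageI)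
    have "inj_on (\<psi> x) (ball y \<epsilon>)"
    proof (rule inj_onI)
      fix p q assume pq: "p \<in> ball y \<epsilon>" "q \<in> ball y \<epsilon>" "\<psi> x p = \<psi> x q"
      hence Y: "p \<in> Y x" "q \<in> Y x" using \<epsilon> by auto
      with pq have "F (c x p) = F (c x q)" by (simp add: Fc)
      moreover have "c x p \<in> ball (c x y) r" "c x q \<in> ball (c x y) r" using \<epsilon>(2) pq by auto
      ultimately have "c x p = c x q" by (rule inj_onD[OF r(3)])
      hence "Complex x p = Complex x q" using c(2)[OF Y(1)] c(2)[OF Y(2)] by metis
      thus "p = q" by (simp only: complex.inject)
    qed
    thus "\<exists>\<epsilon>>0. ball y \<epsilon> \<subseteq> Y x \<and> inj_on (\<psi> x) (ball y \<epsilon>)" using \<epsilon> by auto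
  qed
  have inY: "Im (f z) \<in> Y (Re (f z))" "c (Re (f z)) (Im (f z)) = z" if "z \<in> D" for z
    using that injf by (auto simp: Y_def c_def)
  show "inj_on F D"
  proof (rule inj_onI)
    fix z w assume zw: "z \<in> D" "w \<in> D" "F z = F w"
    define x where "x = Re (f z)"
    have x: "Re (f w) = x" unfolding x_def using zw Re_eq by metis
    have "\<psi> x (Im (f z)) = \<psi> x (Im (f w))"
      using inY(2)[OF zw(1)] inY(2)[OF zw(2)] zw(3) x unfolding \<psi>_def x_def by simp
    hence "Im (f z) = Im (f w)"
      using inj\<psi>[of x] inY(1)[OF zw(1)] inY(1)[OF zw(2)] x unfolding x_def by (metis inj_onD)
    hence "f z = f w" using x by (simp add: x_def complex_eq_iff)
    thus "z = w" using zw(1,2) by (rule inj_onD[OF injf])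
  qed
  have "{w. Re w = x} \<inter> F ` D = (\<lambda>y. F (c x y)) ` Y x"
  proof safe
    fix z assume "z \<in> D" "x = Re (F z)"
    thus "F z \<in> (\<lambda>y. F (c (Re (F z)) y)) ` Y (Re (F z))"
      using inY[of z] Re_eq by (auto intro!: image_eqI[of _ _ "Im (f z)"])
  next
    fix y assume y: "y \<in> Y x"
    show "F (c x y) \<in> F ` D" using c(1)[OF y] by (rule imageI)
    show "Re (F (c x y)) = x" using Fc[OF y] by simp
  qed
  thus "connected ({w. Re w = x} \<inter> F ` D)"
    using intY by (simp only: is_interval_connected connected_continuous_image[OF contFc])
qed

section \<open>Taylor coefficients on the disc\<close>

lemma taylor_sums:
  assumes "F holomorphic_on unit_disc" "z \<in> unit_disc"
  shows "(\<lambda>n. taylor_coeff F n * z ^ n) sums F z"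
  using holomorphic_power_series[OF assms] by (simp add: taylor_coeff_def fps_expansion_def)

lemma symmetric_of_real_coeffs:
  assumes hol: "F holomorphic_on unit_disc" and real: "\<And>n. taylor_coeff F n \<in> \<real>" and z: "z \<in> unit_disc"
  shows "F (cnj z) = cnj (F z)"
proof -
  have "(\<lambda>n. taylor_coeff F n * cnj z ^ n) sums F (cnj z)" using hol z by (intro taylor_sums) auto
  moreover have "(\<lambda>n. cnj (taylor_coeff F n * z ^ n)) sums cnj (F z)"
    using taylor_sums[OF hol z] by (simp only: sums_cnj)
  hence "(\<lambda>n. taylor_coeff F n * cnj z ^ n) sums cnj (F z)"
    using real by (simp add: Reals_cnj_iff)
  ultimately show ?thesis by (rule sums_unique2)
qed

lemma taylor_coeff_cong:
  assumes "\<And>z. z \<in> unit_disc \<Longrightarrow> h' z = h z"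
  shows "taylor_coeff h' n = taylor_coeff h n"
proof -
  have "\<forall>\<^sub>F z in nhds 0. h' z = h z"
    using assms eventually_nhds_in_open[of unit_disc 0] by (auto elim!: eventually_mono)
  thus ?thesis unfolding taylor_coeff_def by (metis fps_expansion_cong)
qed

lemma taylor_coeff_0: "taylor_coeff h 0 = h 0"
  and taylor_coeff_1: "taylor_coeff h 1 = deriv h 0"
  by (simp_all add: taylor_coeff_def fps_expansion_def)

lemma taylor_coeff_add:
  assumes "h holomorphic_on unit_disc" "g holomorphic_on unit_disc"
  shows "taylor_coeff (\<lambda>z. h z + g z) n = taylor_coeff h n + taylor_coeff g n"
  using higher_deriv_add[OF assms, of 0 n]
  by (simp add: taylor_coeff_def fps_expansion_def add_divide_distrib)

text \<open>
  The Cauchy estimate on the circle of radius \<open>r\<close>, with \<open>r \<rightarrow> 1\<close>.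
\<close>

lemma taylor_coeff_norm_le:
  assumes hol: "\<omega> holomorphic_on unit_disc" and bound: "\<And>z. z \<in> unit_disc \<Longrightarrow> norm (\<omega> z) \<le> 1"
  shows "norm (taylor_coeff \<omega> n) \<le> 1"
proof (rule tendsto_lowerbound)
  have "((\<lambda>r::real. 1 / r ^ n) \<longlongrightarrow> 1 / 1 ^ n) (at_left 1)" by (intro tendsto_intros) auto
  thus "((\<lambda>r. 1 / r ^ n) \<longlongrightarrow> (1::real)) (at_left 1)" by simp
  have le: "norm (taylor_coeff \<omega> n) \<le> 1 / r ^ n" if r: "0 < r" "r < 1" for r
  proof -
    have sub: "cball 0 r \<subseteq> unit_disc" using r by auto
    have "norm ((deriv ^^ n) \<omega> 0) \<le> fact n * 1 / r ^ n"
      by (rule Cauchy_inequality)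
         (use r sub in \<open>auto intro!: bound holomorphic_on_imp_continuous_on holomorphic_on_subset[OF hol]\<close>)
    thus ?thesis by (simp add: taylor_coeff_def fps_expansion_def norm_divide field_simps)
  qed
  show "\<forall>\<^sub>F r in at_left 1. norm (taylor_coeff \<omega> n) \<le> 1 / r ^ n"
    using eventually_at_left_real[of 0 1] by (auto elim!: eventually_mono intro: le)
qed simp

section \<open>Moving planes and typical reality\<close>

lemma deriv_cnj_symmetric:
  assumes hol: "F holomorphic_on unit_disc" and sym: "\<And>z. z \<in> unit_disc \<Longrightarrow> F (cnj z) = cnj (F z)"
    and z: "z \<in> unit_disc"
  shows "deriv F (cnj z) = cnj (deriv F z)"
proof -
  have "(F has_field_derivative deriv F z) (at (cnj (cnj z)))"
    using hol z by (simp add: holomorphic_derivI)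
  hence "((cnj \<circ> F \<circ> cnj) has_field_derivative cnj (deriv F z)) (at (cnj z))"
    using has_field_derivative_cnj_cnj by blast
  hence "(F has_field_derivative cnj (deriv F z)) (at (cnj z))"
    by (rule has_field_derivative_transform_within_open[where S = unit_disc]) (use z in \<open>auto simp: sym\<close>)
  thus ?thesis by (rule DERIV_imp_deriv)
qed

text \<open>
  The image of \<open>F\<close> is symmetric about the real axis and vertically convex, so it contains the
  reflection in the line \<open>Im w = \<mu>\<close> of its part above this line. By the symmetry of \<open>F\<close>, pulling
  the reflected point back to the disc gives, up to conjugation, the value at \<open>\<xi>\<close> of the holomorphic
  map \<open>\<xi> \<mapsto> K (F \<xi> - 2 \<i> \<mu>)\<close>. Its quotient by \<open>\<xi>\<close> has modulus \<open>1\<close> on the line and limit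
  superior at most \<open>1\<close> at the unit circle, whatever \<open>F\<close> does there, and the maximum principle
  applies. In terms of the Green function \<open>- ln \<bar>K\<bar>\<close> of the image this is the moving plane
  inequality.
\<close>

lemma moving_plane:
  assumes hol: "F holomorphic_on unit_disc"
    and conv: "\<And>x. connected ({w. Re w = x} \<inter> F ` unit_disc)"
    and sym: "\<And>z. z \<in> unit_disc \<Longrightarrow> F (cnj z) = cnj (F z)"
    and holK: "K holomorphic_on F ` unit_disc" and K: "\<And>z. z \<in> unit_disc \<Longrightarrow> K (F z) = z"
    and lam: "0 < \<mu>" and \<xi>: "\<xi> \<in> unit_disc" "\<mu> \<le> Im (F \<xi>)"
  shows "norm (K (F \<xi> - 2 * \<i> * of_real \<mu>)) \<le> norm \<xi>"
proof -
  define \<phi> where "\<phi> = (\<lambda>z. K (F z - 2 * \<i> * of_real \<mu>) / z)"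
  define H where "H = {z \<in> unit_disc. \<mu> \<le> Im (F z)}"
  have F0: "Im (F 0) = 0" using sym[of 0] by (simp add: complex_eq_iff)
  have H0: "z \<noteq> 0" if "z \<in> H" for z using that lam F0 by (auto simp: H_def)
  have cnj_mem: "cnj w \<in> F ` unit_disc" if "w \<in> F ` unit_disc" for w
    using that sym by (metis (no_types, lifting) complex_mod_cnj imageE imageI mem_ball_0)
  have mem: "F z - 2 * \<i> * of_real \<mu> \<in> F ` unit_disc" if "z \<in> H" for z
  proof -
    have z: "z \<in> unit_disc" "\<mu> \<le> Im (F z)" using that by (auto simp: H_def)
    have "Complex (Re (F z)) (Im (F z) - 2 * \<mu>) \<in> F ` unit_disc"
    proof (rule connected_on_vertical_line[OF conv, where a = "- Im (F z)" and b = "Im (F z)"])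
      show "Complex (Re (F z)) (Im (F z)) \<in> F ` unit_disc" using z by simp
      have "Complex (Re (F z)) (- Im (F z)) = cnj (F z)" by (simp add: complex_eq_iff)
      thus "Complex (Re (F z)) (- Im (F z)) \<in> F ` unit_disc" using cnj_mem z by simp
    qed (use z lam in auto)
    also have "Complex (Re (F z)) (Im (F z) - 2 * \<mu>) = F z - 2 * \<i> * of_real \<mu>"
      by (simp add: complex_eq_iff)
    finally show ?thesis .
  qed
  have K_disc: "norm (K w) < 1" if "w \<in> F ` unit_disc" for w using that K by auto
  have cont: "continuous_on H \<phi>" unfolding \<phi>_def
    by (intro continuous_intros continuous_on_compose2[OF holomorphic_on_imp_continuous_on[OF holK]]
          holomorphic_on_imp_continuous_on[OF holomorphic_on_subset[OF hol]])
       (use mem H0 in \<open>auto simp: H_def\<close>)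
  have on_line: "norm (K (F z - 2 * \<i> * of_real \<mu>)) = norm z" if "z \<in> unit_disc" "Im (F z) = \<mu>" for z
  proof -
    have "F z - 2 * \<i> * of_real \<mu> = cnj (F z)" using that by (simp add: complex_eq_iff)
    also have "\<dots> = F (cnj z)" using sym that by simp
    finally show ?thesis using K[of "cnj z"] that by simp
  qed
  have bound: "norm (\<phi> \<xi>) \<le> 1 / r" if r: "norm \<xi> < r" "r < 1" for r
  proof -
    have r0: "r > 0" using r norm_ge_zero[of \<xi>] by linarith
    hence r1: "1 \<le> 1 / r" using r by simp
    define S where "S = {z \<in> ball 0 r. \<mu> < Im (F z)}"
    have sub: "ball 0 r \<subseteq> unit_disc" "cball 0 r \<subseteq> unit_disc" using r by auto
    have contF: "continuous_on (cball 0 r) (\<lambda>z. Im (F z))"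
      by (intro continuous_intros holomorphic_on_imp_continuous_on[OF holomorphic_on_subset[OF hol sub(2)]])
    have "S = ball 0 r \<inter> (\<lambda>z. Im (F z)) -` {\<mu><..}" by (auto simp: S_def)
    hence openS: "open S"
      using continuous_on_subset[OF contF ball_subset_cball] by (simp add: continuous_open_preimage)
    have "closed (cball 0 r \<inter> (\<lambda>z. Im (F z)) -` {\<mu>..})"
      using contF by (intro continuous_closed_preimage) auto
    hence clS: "closure S \<subseteq> cball 0 r \<inter> (\<lambda>z. Im (F z)) -` {\<mu>..}"
      by (intro closure_minimal) (auto simp: S_def)
    hence clH: "closure S \<subseteq> H" using sub by (auto simp: H_def)
    have SH: "S \<subseteq> H" using clH closure_subset by blast
    show ?thesis
    proof (cases "Im (F \<xi>) = \<mu>")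
      case True
      have "norm (\<phi> \<xi>) \<le> 1" using on_line[OF \<xi>(1) True] by (simp add: \<phi>_def norm_divide)
      thus ?thesis using r1 by simp
    next
      case False
      show ?thesis
      proof (rule maximum_modulus_frontier[where f = \<phi> and S = S])
        have "(\<lambda>z. F z - 2 * \<i> * of_real \<mu>) holomorphic_on S"
          by (intro holomorphic_intros holomorphic_on_subset[OF hol]) (auto simp: S_def intro: less_trans[OF _ r(2)])
        moreover have "(\<lambda>z. F z - 2 * \<i> * of_real \<mu>) ` S \<subseteq> F ` unit_disc" using SH mem by blast
        ultimately have "(\<lambda>z. K (F z - 2 * \<i> * of_real \<mu>)) holomorphic_on S"
          using holomorphic_on_compose_gen[OF _ holK] unfolding o_def by blast
        hence "\<phi> holomorphic_on S" unfolding \<phi>_def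
          by (rule holomorphic_on_divide) (use SH H0 in \<open>auto intro!: holomorphic_intros\<close>)
        thus "\<phi> holomorphic_on interior S" using openS by (simp add: interior_open)
        show "continuous_on (closure S) \<phi>" using cont clH by (rule continuous_on_subset)
        show "bounded S" by (rule bounded_subset[of "ball 0 r"]) (auto simp: S_def)
        show "\<xi> \<in> S" using r \<xi> False by (simp add: S_def)
        fix z assume z: "z \<in> frontier S"
        hence zH: "z \<in> H" and zr: "norm z \<le> r" and "z \<notin> S"
          using clS clH openS by (auto simp: frontier_def interior_open)
        hence "norm z = r \<or> Im (F z) = \<mu>" by (auto simp: S_def H_def)
        thus "norm (\<phi> z) \<le> 1 / r"
        proof
          assume "norm z = r"
          thus ?thesis using K_disc[OF mem[OF zH]] r0 by (simp add: \<phi>_def norm_divide divide_right_mono)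
        next
          assume "Im (F z) = \<mu>"
          hence "norm (\<phi> z) \<le> 1" using on_line[of z] zH by (simp add: \<phi>_def norm_divide H_def)
          thus ?thesis using r1 by simp
        qed
      qed
    qed
  qed
  have "norm (\<phi> \<xi>) \<le> 1"
  proof (rule tendsto_lowerbound)
    have "((\<lambda>r::real. 1 / r) \<longlongrightarrow> 1 / 1) (at_left 1)" by (intro tendsto_intros) auto
    thus "((\<lambda>r. 1 / r) \<longlongrightarrow> (1::real)) (at_left 1)" by simp
    show "eventually (\<lambda>r. norm (\<phi> \<xi>) \<le> 1 / r) (at_left 1)"
      using eventually_at_left_real[of "norm \<xi>" 1] \<xi> bound by (auto elim!: eventually_mono)
  qed simp
  moreover have "\<xi> \<noteq> 0" using H0[of \<xi>] \<xi> by (simp add: H_def)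
  ultimately show ?thesis by (simp add: \<phi>_def norm_divide field_simps)
qed

text \<open>
  Letting the line in the moving plane inequality pass through \<open>F z\<close> shows that
  \<open>t \<mapsto> \<bar>K (F z + \<i> t)\<bar>\<^sup>2\<close> is at least as large at \<open>t\<close> as at \<open>-t\<close> for small \<open>t > 0\<close>. Its
  derivative at \<open>0\<close> is a positive multiple of \<open>Im (z F' z)\<close>.
\<close>

lemma angular_monotonicity:
  assumes hol: "F holomorphic_on unit_disc" and inj: "inj_on F unit_disc"
    and conv: "\<And>x. connected ({w. Re w = x} \<inter> F ` unit_disc)"
    and sym: "\<And>z. z \<in> unit_disc \<Longrightarrow> F (cnj z) = cnj (F z)"
    and z: "z \<in> unit_disc" and pos: "0 < Im (F z)"
  shows "0 \<le> Im (z * deriv F z)"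
proof -
  obtain K where holK: "K holomorphic_on F ` unit_disc"
    and dK: "\<And>z. z \<in> unit_disc \<Longrightarrow> deriv F z * deriv K (F z) = 1"
    and K: "\<And>z. z \<in> unit_disc \<Longrightarrow> K (F z) = z"
    using holomorphic_has_inverse[OF hol open_ball inj] by blast
  have openF: "open (F ` unit_disc)" using open_mapping_thm3[OF hol open_ball inj] .
  define m where "m = (\<lambda>t. (norm (K (F z + \<i> * of_real t)))\<^sup>2)"
  have F': "deriv F z \<noteq> 0" using dK[OF z] by auto
  have dK': "deriv K (F z) = 1 / deriv F z" using dK[OF z] F' by (simp add: field_simps)
  define D where "D = 2 * (Im (z * deriv F z) / (norm (deriv F z))\<^sup>2)"
  have m': "(m has_real_derivative D) (at 0)"
  proof -
    define k where "k = (\<lambda>t. K (F z + \<i> * of_real t))"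
    have "(K has_field_derivative deriv K (F z)) (at (F z + \<i> * of_real 0))"
      using holK openF z by (simp add: holomorphic_derivI)
    moreover have "((\<lambda>t. F z + \<i> * of_real t) has_vector_derivative \<i>) (at 0)"
      by (auto intro!: derivative_eq_intros simp: has_vector_derivative_def fun_eq_iff scaleR_conv_of_real)
    ultimately have k': "(k has_vector_derivative \<i> * deriv K (F z)) (at 0)"
      using field_vector_diff_chain_at[of "\<lambda>t. F z + \<i> * of_real t" \<i> 0 K] by (simp add: k_def o_def)
    have "((\<lambda>t. Re (k t)) has_real_derivative Re (\<i> * deriv K (F z))) (at 0)"
      "((\<lambda>t. Im (k t)) has_real_derivative Im (\<i> * deriv K (F z))) (at 0)"
      using bounded_linear.has_vector_derivative[OF bounded_linear_Re k']
        bounded_linear.has_vector_derivative[OF bounded_linear_Im k']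
      by (simp_all add: has_real_derivative_iff_has_vector_derivative)
    note Re_Im = DERIV_add[OF DERIV_power[OF this(1), of 2] DERIV_power[OF this(2), of 2]]
    have m_eq: "m = (\<lambda>t. (Re (k t))\<^sup>2 + (Im (k t))\<^sup>2)" by (simp add: m_def k_def cmod_power2)
    have D_eq: "D = 2 * (Re z * Re (\<i> * deriv K (F z)) + Im z * Im (\<i> * deriv K (F z)))"
      unfolding D_def dK' by (simp add: Re_divide Im_divide cmod_power2 add_divide_distrib diff_divide_distrib algebra_simps)
    show ?thesis unfolding m_eq D_eq using Re_Im K[OF z] by (simp add: k_def algebra_simps)
  qed
  have mono: "\<forall>\<^sub>F t in at_right 0. m (- t) \<le> m t"
  proof -
    have "((\<lambda>t. F z + \<i> * of_real t) \<longlongrightarrow> F z + \<i> * of_real 0) (at_right 0)"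
      "((\<lambda>t. F z - \<i> * of_real t) \<longlongrightarrow> F z - \<i> * of_real 0) (at_right 0)"
      by (intro tendsto_intros)+
    hence "\<forall>\<^sub>F t in at_right 0. F z + \<i> * of_real t \<in> F ` unit_disc"
      "\<forall>\<^sub>F t in at_right 0. F z - \<i> * of_real t \<in> F ` unit_disc"
      using z by (auto elim!: topological_tendstoD intro!: openF)
    moreover have "\<forall>\<^sub>F t in at_right 0. (0::real) < t" by (rule eventually_at_right_less)
    ultimately show ?thesis
    proof eventually_elim
      case (elim t)
      obtain \<xi> where \<xi>: "\<xi> \<in> unit_disc" "F \<xi> = F z + \<i> * of_real t" using elim(1) by fastforce
      obtain \<zeta> where \<zeta>: "\<zeta> \<in> unit_disc" "F \<zeta> = F z - \<i> * of_real t" using elim(2) by fastforce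
      have "F \<xi> - 2 * \<i> * of_real (Im (F z)) = F (cnj \<zeta>)"
        using sym[OF \<zeta>(1)] \<xi>(2) \<zeta>(2) by (simp add: complex_eq_iff)
      hence "K (F \<xi> - 2 * \<i> * of_real (Im (F z))) = cnj \<zeta>" using K[of "cnj \<zeta>"] \<zeta>(1) by simp
      hence "norm \<zeta> \<le> norm \<xi>"
        using moving_plane[OF hol conv sym holK K pos \<xi>(1)] \<xi>(2) elim(3) by simp
      thus ?case
        using K[OF \<xi>(1)] K[OF \<zeta>(1)] \<xi>(2) \<zeta>(2) by (simp add: m_def)
    qed
  qed
  have "\<not> D < 0"
  proof
    assume "D < 0"
    have "((\<lambda>t. m t - m (- t)) has_real_derivative D - D * (- 1)) (at 0)"
      by (rule DERIV_diff[OF m' DERIV_chain2[of m D "\<lambda>t. - t"]]) (use m' in \<open>auto intro!: derivative_eq_intros\<close>)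
    hence "((\<lambda>t. m t - m (- t)) has_real_derivative 2 * D) (at 0)" by simp
    then obtain d where d: "d > 0" "\<And>h. 0 < h \<Longrightarrow> h < d \<Longrightarrow> m h < m (- h)"
      using DERIV_neg_dec_right[of "\<lambda>t. m t - m (- t)" "2 * D" 0] \<open>D < 0\<close> by auto
    have "\<forall>\<^sub>F t in at_right 0. t \<in> {0<..<d}" using d(1) by (rule eventually_at_right_real)
    with mono have "\<forall>\<^sub>F t in at_right (0::real). False"
      by eventually_elim (use d(2) in force)
    thus False by simp
  qed
  thus ?thesis using F' by (simp add: D_def zero_le_divide_iff not_less)
qed

text \<open>
  By symmetry and injectivity \<open>F\<close> is real only on the real axis, so \<open>Im F\<close> has constant sign on
  the upper half disc; the sign is read off next to the origin on the imaginary axis.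
\<close>

lemma univalent_symmetric_Im_pos:
  assumes hol: "F holomorphic_on unit_disc" and inj: "inj_on F unit_disc"
    and sym: "\<And>z. z \<in> unit_disc \<Longrightarrow> F (cnj z) = cnj (F z)" and F'0: "deriv F 0 = 1"
    and z: "z \<in> unit_disc" "0 < Im z"
  shows "0 < Im (F z)"
proof -
  define U where "U = unit_disc \<inter> {z. 0 < Im z}"
  have nz: "Im (F w) \<noteq> 0" if "w \<in> U" for w
  proof
    assume "Im (F w) = 0"
    hence "F (cnj w) = F w" using sym that by (simp add: U_def complex_eq_iff)
    hence "cnj w = w" by (rule inj_onD[OF inj]) (use that in \<open>auto simp: U_def\<close>)
    thus False using that by (simp add: U_def complex_eq_iff)
  qed
  have "convex U" unfolding U_def by (intro convex_Int convex_ball convex_halfspace_Im_gt)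
  hence "connected ((\<lambda>w. Im (F w)) ` U)"
    by (intro connected_continuous_image continuous_intros convex_connected
          holomorphic_on_imp_continuous_on[OF holomorphic_on_subset[OF hol]]) (auto simp: U_def)
  note conn = connectedD_interval[OF this]
  have "\<exists>w\<in>U. 0 < Im (F w)"
  proof -
    have F0: "Im (F 0) = 0" using sym[of 0] by (simp add: complex_eq_iff)
    have "(F has_field_derivative 1) (at (\<i> * of_real 0))"
      using holomorphic_derivI[OF hol, of 0] F'0 by simp
    moreover have "((\<lambda>t. \<i> * of_real t) has_vector_derivative \<i>) (at 0)"
      by (auto intro!: derivative_eq_intros simp: has_vector_derivative_def fun_eq_iff scaleR_conv_of_real)
    ultimately have "((\<lambda>t. F (\<i> * of_real t)) has_vector_derivative \<i>) (at 0)"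
      using field_vector_diff_chain_at[of "\<lambda>t. \<i> * of_real t" \<i> 0 F 1] by (simp add: o_def)
    from bounded_linear.has_vector_derivative[OF bounded_linear_Im this]
    have "((\<lambda>t. Im (F (\<i> * of_real t))) has_real_derivative 1) (at 0)"
      by (simp add: has_real_derivative_iff_has_vector_derivative)
    then obtain d where d: "d > 0" "\<And>h. 0 < h \<Longrightarrow> h < d \<Longrightarrow> Im (F (\<i> * of_real 0)) < Im (F (\<i> * of_real (0 + h)))"
      using DERIV_pos_inc_right[of "\<lambda>t. Im (F (\<i> * of_real t))" 1 0] by auto
    have "\<i> * of_real (min d 1 / 2) \<in> U" using d(1) by (auto simp: U_def norm_mult)
    moreover have "0 < Im (F (\<i> * of_real (min d 1 / 2)))" using d(2)[of "min d 1 / 2"] d(1) F0 by simp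
    ultimately show ?thesis by blast
  qed
  then obtain w where w: "w \<in> U" "0 < Im (F w)" by blast
  show ?thesis
  proof (rule ccontr)
    assume "\<not> 0 < Im (F z)"
    hence "0 \<in> (\<lambda>w. Im (F w)) ` U" using conn[of "Im (F z)" "Im (F w)" 0] w z by (auto simp: U_def)
    thus False using nz by auto
  qed
qed

lemma typically_real_of_vertically_convex:
  assumes hol: "F holomorphic_on unit_disc" and inj: "inj_on F unit_disc"
    and conv: "\<And>x. connected ({w. Re w = x} \<inter> F ` unit_disc)"
    and sym: "\<And>z. z \<in> unit_disc \<Longrightarrow> F (cnj z) = cnj (F z)" and F'0: "deriv F 0 = 1"
    and z: "z \<in> unit_disc"
  shows "0 \<le> Im z * Im (z * deriv F z)"
proof -
  have upper: "0 \<le> Im (w * deriv F w)" if "w \<in> unit_disc" "0 < Im w" for w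
    using angular_monotonicity[OF hol inj conv sym that(1)]
      univalent_symmetric_Im_pos[OF hol inj sym F'0 that] by blast
  consider "0 < Im z" | "Im z = 0" | "Im z < 0" by linarith
  thus ?thesis
  proof cases
    case 1
    thus ?thesis using upper[OF z] by simp
  next
    case 3
    have "0 \<le> Im (cnj z * deriv F (cnj z))" using upper[of "cnj z"] z 3 by simp
    also have "cnj z * deriv F (cnj z) = cnj (z * deriv F z)"
      using deriv_cnj_symmetric[OF hol sym z] by simp
    finally have "Im (z * deriv F z) \<le> 0" by simp
    thus ?thesis using 3 by (intro mult_nonpos_nonpos) auto
  qed simp
qed

section \<open>Half-integer coefficients\<close>

text \<open>
  The numbers \<open>s n\<close> are twice the Taylor coefficients of \<open>F\<close>, and the \<open>e n\<close> twice the entries of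
  the Toeplitz form attached to \<open>(1 - z\<^sup>2) F'\<close>. The bound \<open>\<bar>e n\<bar> \<le> 4\<close> compares \<open>(n + 2) s (n + 2)\<close>
  with \<open>n s n\<close>, so it leaves a single integer for \<open>s (n + 2)\<close> once \<open>n\<close> is large: the sequence becomes
  2-periodic, and only \<open>s 2, \<dots>, s 7\<close> have to be discussed. If \<open>s 3 = 2\<close>, the entry \<open>e 2\<close> is extremal
  and \<open>e\<close> is 2-periodic. The other initial segments that are not among the solutions either contain
  an extremal entry with the wrong reflection or are refuted by an explicit vector on which the form
  is negative.
\<close>

lemma half_integer_toeplitz_classification:
  fixes s :: "nat \<Rightarrow> int" and e :: "nat \<Rightarrow> int"
  assumes s1: "s 1 = 2" and e0: "e 0 = 4"
    and e_Suc: "\<And>n. e (Suc n) = int (n + 2) * s (n + 2) - int n * s n"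
    and psd: "psd_toeplitz (\<lambda>n. of_int (e n))"
  obtains A B where "\<And>n. odd n \<Longrightarrow> n \<ge> 3 \<Longrightarrow> s n = A" "\<And>n. even n \<Longrightarrow> n \<ge> 2 \<Longrightarrow> s n = B"
    "A = 2 \<and> \<bar>B\<bar> \<le> 2 \<or> A = 1 \<and> \<bar>B\<bar> \<le> 1 \<or> A = 0 \<and> B = 0"
proof -
  have bound: "\<bar>e n\<bar> \<le> 4" for n
    using psd_toeplitz_bound[OF psd, of n] e0 by (simp del: of_int_abs add: of_int_abs[symmetric])
  have shift: "e (n + m) = \<sigma> * e n" "n \<le> m \<Longrightarrow> e (m - n) = \<sigma> * e n"
    if "m > 0" "\<bar>\<sigma>\<bar> = 1" "e m = \<sigma> * 4" for m n \<sigma>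
  proof -
    have "\<bar>real_of_int \<sigma>\<bar> = 1" using that(2) by linarith
    moreover have "real_of_int (e m) = of_int \<sigma> * of_int (e 0)" using that e0 by simp
    ultimately show "e (n + m) = \<sigma> * e n" "n \<le> m \<Longrightarrow> e (m - n) = \<sigma> * e n"
      using psd_toeplitz_extremal[OF psd \<open>m > 0\<close>, of "of_int \<sigma>" n]
      by (metis of_int_eq_iff of_int_mult)+
  qed
  have cert: "0 \<le> (\<Sum>j<N. \<Sum>k<N. xs ! j * xs ! k * e ((j - k) + (k - j)))"
    if "length xs = N" for xs N
  proof -
    have "0 \<le> real_of_int (\<Sum>j<length xs. \<Sum>k<length xs. xs ! j * xs ! k * e ((j - k) + (k - j)))"
      using psd_toeplitz_list[OF psd, of "map real_of_int xs"] by simp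
    hence "0 \<le> (\<Sum>j<length xs. \<Sum>k<length xs. xs ! j * xs ! k * e ((j - k) + (k - j)))" by linarith
    thus ?thesis using that by simp
  qed
  have e1: "e 1 = 2 * s 2" and e2: "e 2 = 3 * s 3 - 2" and e3: "e 3 = 4 * s 4 - 2 * s 2"
    and e4: "e 4 = 5 * s 5 - 3 * s 3" and e5: "e 5 = 6 * s 6 - 4 * s 4"
    and e6: "e 6 = 7 * s 7 - 5 * s 5"
    using e_Suc[of 0] e_Suc[of 1] e_Suc[of 2] e_Suc[of 3] e_Suc[of 4] e_Suc[of 5] s1
    by (simp_all add: eval_nat_numeral)
  have b: "\<bar>2 * s 2\<bar> \<le> 4" "\<bar>3 * s 3 - 2\<bar> \<le> 4" "\<bar>4 * s 4 - 2 * s 2\<bar> \<le> 4" "\<bar>5 * s 5 - 3 * s 3\<bar> \<le> 4"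
     "\<bar>6 * s 6 - 4 * s 4\<bar> \<le> 4" "\<bar>7 * s 7 - 5 * s 5\<bar> \<le> 4"
    using bound[of 1] bound[of 2] bound[of 3] bound[of 4] bound[of 5] bound[of 6]
    by (simp_all add: e1 e2 e3 e4 e5 e6 flip: One_nat_def)
  \<comment> \<open>The duplicates with \<open>Suc\<close> match the normal form of small index differences.\<close>
  note expand = e0 e1 e1[unfolded One_nat_def] e2 e2[unfolded numeral_2_eq_2] e3 e4 e5 e6
  have sums: "(\<Sum>j<4. f j) = f 0 + f 1 + f 2 + f 3"
    "(\<Sum>j<5. f j) = f 0 + f 1 + f 2 + f 3 + f 4"
    "(\<Sum>j<6. f j) = f 0 + f 1 + f 2 + f 3 + f 4 + f 5"
    "(\<Sum>j<7. f j) = f 0 + f 1 + f 2 + f 3 + f 4 + f 5 + f 6" for f :: "nat \<Rightarrow> int"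
    by (simp_all add: eval_nat_numeral)
  \<comment> \<open>With the claimed value of \<open>s (n + 2)\<close>, the modulus of \<open>e (n + 1)\<close> is 0 or 2. Any
    other integer moves \<open>e (n + 1)\<close> by at least \<open>n + 2\<close> and thus beyond the bound 4.\<close>
  have tail0: "s (n + 2) = 0" if "s n = 0" "n \<ge> 3" for n
  proof (rule ccontr)
    assume "s (n + 2) \<noteq> 0"
    hence "1 \<le> \<bar>s (n + 2)\<bar>" by linarith
    hence "int (n + 2) * 1 \<le> int (n + 2) * \<bar>s (n + 2)\<bar>" by (intro mult_left_mono) auto
    also have "\<dots> = \<bar>int (n + 2) * s (n + 2)\<bar>" by (simp add: abs_mult)
    also have "\<dots> \<le> 4" using bound[of "Suc n"] e_Suc[of n] that by simp
    finally show False using that by simp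
  qed
  have tail1: "s (n + 2) = \<sigma>" if "s n = \<sigma>" "\<bar>\<sigma>\<bar> = 1" "n \<ge> 5" for n \<sigma>
  proof (rule ccontr)
    assume "s (n + 2) \<noteq> \<sigma>"
    hence "1 \<le> \<bar>s (n + 2) - \<sigma>\<bar>" by linarith
    hence "int (n + 2) * 1 \<le> int (n + 2) * \<bar>s (n + 2) - \<sigma>\<bar>" by (intro mult_left_mono) auto
    also have "\<dots> = \<bar>int (n + 2) * (s (n + 2) - \<sigma>)\<bar>" by (simp only: abs_mult abs_of_nat)
    also have "\<dots> = \<bar>int (n + 2) * s (n + 2) - int n * s n - 2 * \<sigma>\<bar>"
      using that(1) by (simp add: algebra_simps)
    also have "\<dots> \<le> 4 + 2" using bound[of "Suc n"] e_Suc[of n] that(2) by linarith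
    finally show False using that by simp
  qed
  have propagate: "s n = s m" if step: "\<And>k. k \<ge> m \<Longrightarrow> s k = s m \<Longrightarrow> s (k + 2) = s m"
      and le: "n \<ge> m" and ev: "even (n - m)" for n m
  proof -
    obtain k where "n - m = 2 * k" using ev by (rule evenE)
    hence k: "n = m + 2 * k" using le by simp
    have "s (m + 2 * k) = s m" by (induction k) (use step in auto)
    thus ?thesis using k by simp
  qed
  have s2: "\<bar>s 2\<bar> \<le> 1" if "s 3 \<noteq> 2"
  proof (rule ccontr)
    assume "\<not> ?thesis"
    hence "s 2 = 2 \<or> s 2 = -2" using b(1) by linarith
    hence "e 1 = 1 * 4 \<or> e 1 = -1 * 4" using e1 by auto
    hence "e 2 = 4" using shift(1)[of 1 _ 1] by (auto simp: numeral_2_eq_2)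
    thus False using e2 that by simp
  qed
  note that_thesis = that
  consider "s 3 = 2" | "s 3 = 1" | "s 3 = 0" using b(2) by linarith
  thus thesis
  proof cases
    case 1
    have e_even: "e (2 * k) = 4" for k
      by (induction k) (use e0 shift(1)[of 2 1] e2 1 in \<open>auto simp: eval_nat_numeral\<close>)
    have e_odd: "e (2 * k + 1) = 2 * s 2" for k
    proof (induction k)
      case (Suc k)
      thus ?case using shift(1)[of 2 1 "2 * k + 1"] e2 1 by (simp add: eval_nat_numeral)
    qed (use e1 in simp)
    have s_odd: "s (2 * k + 1) = 2" for k
    proof (induction k)
      case (Suc k)
      have "int (2 * k + 3) * s (2 * k + 3) = int (2 * k + 3) * 2"
        using e_even[of "Suc k"] e_Suc[of "2 * k + 1"] Suc by (simp add: algebra_simps eval_nat_numeral)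
      hence "s (2 * k + 3) = 2" by (subst (asm) mult_cancel_left) auto
      thus ?case by (simp add: eval_nat_numeral)
    qed (use s1 in simp)
    have s_even: "s (2 * k + 2) = s 2" for k
    proof (induction k)
      case (Suc k)
      have "int (2 * k + 4) * s (2 * k + 4) = int (2 * k + 4) * s 2"
        using e_odd[of "Suc k"] e_Suc[of "2 * k + 2"] Suc by (simp add: algebra_simps eval_nat_numeral)
      hence "s (2 * k + 4) = s 2" by (subst (asm) mult_cancel_left) auto
      thus ?case by (simp add: eval_nat_numeral)
    qed (simp add: numeral_2_eq_2)
    show thesis
    proof (rule that)
      show "s n = 2" if "odd n" for n using s_odd that by (metis oddE)
      show "s n = s 2" if n: "even n" "n \<ge> 2" for n
      proof -
        obtain j where j: "n = 2 * j" using n(1) by (rule evenE)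
        then obtain k where "j = Suc k" using n(2) by (cases j) auto
        hence "n = 2 * Suc k" using j by simp
        thus ?thesis using s_even[of k] by simp
      qed
    qed (use b(1) in auto)
  next
    case 2
    have s5: "s 5 = 0 \<or> s 5 = 1" using b(4) 2 by arith
    \<comment> \<open>The surviving initial segment; from index 5 on it is continued by the tail
      rules.\<close>
    have good: thesis if "s 5 = 1" "s 4 = s 2" "s 6 = s 2" "\<bar>s 2\<bar> \<le> 1"
    proof (rule that_thesis)
      show "s n = 1" if n: "odd n" "n \<ge> 3" for n
      proof (cases "n = 3")
        case False
        hence "n \<ge> 5" using n by presburger
        thus ?thesis using propagate[of 5 n] tail1[of _ 1] \<open>s 5 = 1\<close> n by simp
      qed (use 2 in simp)
      show "s n = s 2" if n: "even n" "n \<ge> 2" for n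
      proof (cases "n = 2 \<or> n = 4")
        case False
        hence "n \<ge> 6" using n by presburger
        moreover have "s (k + 2) = s 6" if "k \<ge> 6" "s k = s 6" for k
          using tail0[of k] tail1[of k "s 2"] \<open>s 6 = s 2\<close> \<open>\<bar>s 2\<bar> \<le> 1\<close> that by (cases "s 2 = 0") auto
        ultimately show ?thesis using propagate[of 6 n] \<open>s 6 = s 2\<close> n by simp
      qed (use \<open>s 4 = s 2\<close> in auto)
    qed (use \<open>\<bar>s 2\<bar> \<le> 1\<close> in simp)
    consider "s 2 = 0" | "s 2 = 1" | "s 2 = -1" using s2 2 by linarith
    thus thesis
    proof cases
      case s2: 1
      have "s 4 = 0"
      proof (rule ccontr)
        assume "s 4 \<noteq> 0"
        hence "\<bar>s 4\<bar> = 1" using b(3) s2 by arith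
        from shift(2)[OF _ this, of 3 1] show False using s2 2 by (simp add: expand)
      qed
      hence s6: "s 6 = 0" using b(5) by arith
      have "s 5 \<noteq> 0"
      proof
        assume "s 5 = 0"
        moreover from this have "s 7 = 0" using b(6) by arith
        ultimately show False using cert[of "[-1, 0, 1, 0, -1, 0, 1]" 7] s2 2 \<open>s 4 = 0\<close> s6
          by (simp add: expand sums)
      qed
      thus thesis using good s5 s2 s6 \<open>s 4 = 0\<close> by simp
    next
      case s2: 2
      have s4: "s 4 = 0 \<or> s 4 = 1" using b(3) s2 by arith
      have 45: "s 4 = 1 \<and> s 5 = 1"
      proof (rule ccontr)
        assume neg: "\<not> ?thesis"
        consider "s 4 = 0" "s 5 = 0" | "s 4 = 0" "s 5 = 1" | "s 4 = 1" "s 5 = 0" using s4 s5 neg by blast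
        thus False
        proof cases
          case 1
          hence "s 6 = 0" using b(5) by arith
          thus False using cert[of "[-1, 1, 1, -1, -1, 1]" 6] 1 2 s2 by (simp add: expand sums)
        next
          case _: 2
          thus False using cert[of "[-1, 1, 0, -1, 1]" 5] 2 s2 \<open>s 3 = 1\<close> by (simp add: expand sums)
        next
          case 3
          thus False using cert[of "[-1, 1, 0, 1, -1]" 5] 2 s2 by (simp add: expand sums)
        qed
      qed
      have "s 6 = 0 \<or> s 6 = 1" using b(5) 45 by arith
      moreover have "s 6 \<noteq> 0"
      proof
        assume "s 6 = 0"
        thus False using cert[of "[-2, 1, 0, 0, 1, -2]" 6] 45 2 s2 by (simp add: expand sums)
      qed
      ultimately show thesis using good 45 s2 by simp
    next
      case s2: 3
      \<comment> \<open>The vectors are those of the previous case with alternating signs, as for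
        \<open>- F (- z)\<close>.\<close>
      have s4: "s 4 = 0 \<or> s 4 = -1" using b(3) s2 by arith
      have 45: "s 4 = -1 \<and> s 5 = 1"
      proof (rule ccontr)
        assume neg: "\<not> ?thesis"
        consider "s 4 = 0" "s 5 = 0" | "s 4 = 0" "s 5 = 1" | "s 4 = -1" "s 5 = 0" using s4 s5 neg by blast
        thus False
        proof cases
          case 1
          hence "s 6 = 0" using b(5) by arith
          thus False using cert[of "[1, 1, -1, -1, 1, 1]" 6] 1 2 s2 by (simp add: expand sums)
        next
          case _: 2
          thus False using cert[of "[1, 1, 0, -1, -1]" 5] 2 s2 \<open>s 3 = 1\<close> by (simp add: expand sums)
        next
          case 3
          thus False using cert[of "[1, 1, 0, 1, 1]" 5] 2 s2 by (simp add: expand sums)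
        qed
      qed
      have "s 6 = 0 \<or> s 6 = -1" using b(5) 45 by arith
      moreover have "s 6 \<noteq> 0"
      proof
        assume "s 6 = 0"
        thus False using cert[of "[2, 1, 0, 0, -1, -2]" 6] 45 2 s2 by (simp add: expand sums)
      qed
      ultimately show thesis using good 45 s2 by simp
    qed
  next
    case 3
    consider "s 2 = 0" | "s 2 = 1" | "s 2 = -1" using s2 3 by linarith
    thus thesis
    proof cases
      case s2: 1
      have s5: "s 5 = 0" using b(4) 3 by arith
      have s4: "s 4 = 0"
      proof (rule ccontr)
        assume "s 4 \<noteq> 0"
        hence "\<bar>s 4\<bar> = 1" using b(3) s2 by arith
        from shift(2)[OF _ this, of 3 1] show False using s2 3 by (simp add: expand)
      qed
      show thesis
      proof (rule that_thesis)
        show "s n = 0" if n: "odd n" "n \<ge> 3" for n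
          using propagate[of 3 n] tail0 3 n by simp
        show "s n = 0" if n: "even n" "n \<ge> 2" for n
        proof (cases "n = 2")
          case False
          hence "n \<ge> 4" using n by presburger
          thus ?thesis using propagate[of 4 n] tail0 s4 n by simp
        qed (use s2 in simp)
      qed simp
    next
      case s2: 2
      have "s 4 = 0 \<or> s 4 = 1" using b(3) s2 by arith
      moreover have "s 4 \<noteq> 0"
      proof
        assume "s 4 = 0"
        thus False using cert[of "[-1, 2, -2, 1]" 4] 3 s2 by (simp add: expand sums)
      qed
      moreover have "s 4 \<noteq> 1"
      proof
        assume "s 4 = 1"
        thus False using cert[of "[-1, 1, -1, 1]" 4] 3 s2 by (simp add: expand sums)
      qed
      ultimately show thesis by blast
    next
      case s2: 3
      have "s 4 = 0 \<or> s 4 = -1" using b(3) s2 by arith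
      moreover have "s 4 \<noteq> 0"
      proof
        assume "s 4 = 0"
        thus False using cert[of "[1, 2, 2, 1]" 4] 3 s2 by (simp add: expand sums)
      qed
      moreover have "s 4 \<noteq> -1"
      proof
        assume "s 4 = -1"
        thus False using cert[of "[1, 1, 1, 1]" 4] 3 s2 by (simp add: expand sums)
      qed
      ultimately show thesis by blast
    qed
  qed
qed

text \<open>
  Grouping the series from \<open>n = 2\<close> on into consecutive pairs gives a geometric series in \<open>z\<^sup>2\<close>.
\<close>

lemma eventually_periodic_power_series:
  assumes hol: "F holomorphic_on unit_disc" and F0: "taylor_coeff F 0 = 0" and F1: "taylor_coeff F 1 = 1"
    and odd: "\<And>n. odd n \<Longrightarrow> n \<ge> 3 \<Longrightarrow> taylor_coeff F n = a"
    and even: "\<And>n. even n \<Longrightarrow> n \<ge> 2 \<Longrightarrow> taylor_coeff F n = b"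
    and z: "z \<in> unit_disc"
  shows "F z = z + (b * z ^ 2 + a * z ^ 3) / (1 - z ^ 2)"
proof -
  define f where "f = (\<lambda>n. taylor_coeff F n * z ^ n)"
  have "f sums F z" unfolding f_def by (rule taylor_sums[OF hol z])
  hence "(\<lambda>n. f (n + 2)) sums (F z - (\<Sum>i<2. f i))" by (rule sums_split_initial_segment)
  hence "(\<lambda>n. f (n + 2)) sums (F z - z)" using F0 F1 by (simp add: f_def numeral_2_eq_2)
  hence "(\<lambda>k. \<Sum>n\<in>{k * 2..<k * 2 + 2}. f (n + 2)) sums (F z - z)" by (rule sums_group) simp
  moreover have "(\<Sum>n\<in>{k * 2..<k * 2 + 2}. f (n + 2)) = (b * z ^ 2 + a * z ^ 3) * (z ^ 2) ^ k" for k
  proof -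
    have "{k * 2..<k * 2 + 2} = {2 * k, 2 * k + 1}" by auto
    moreover have "f (2 * k + 2) = b * z ^ (2 * k + 2)" unfolding f_def by (subst even) auto
    moreover have "f (2 * k + 1 + 2) = a * z ^ (2 * k + 1 + 2)" unfolding f_def by (subst odd) auto
    ultimately show ?thesis
      by (simp add: power_add power_mult eval_nat_numeral algebra_simps)
  qed
  moreover have "norm (z ^ 2) < 1" using z by (simp add: norm_power power_less_one_iff)
  hence "(\<lambda>k. (b * z ^ 2 + a * z ^ 3) * (z ^ 2) ^ k) sums ((b * z ^ 2 + a * z ^ 3) * (1 / (1 - z ^ 2)))"
    by (intro sums_mult geometric_sums)
  ultimately have "F z - z = (b * z ^ 2 + a * z ^ 3) * (1 / (1 - z ^ 2))" by (simp add: sums_unique2)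
  thus ?thesis by (simp add: diff_eq_eq add.commute)
qed

text \<open>
  This is the analytic case: among the normalized univalent functions with half-integer coefficients and
  vertically convex image there are only nine. It serves twice, for \<open>f\<close> itself when \<open>g = 0\<close> and
  for the sum \<open>h + g\<close> otherwise.
\<close>

lemma vertically_convex_half_integer_classification:
  assumes hol: "F holomorphic_on unit_disc" and inj: "inj_on F unit_disc"
    and conv: "\<And>x. connected ({w. Re w = x} \<inter> F ` unit_disc)"
    and coeff: "\<And>n. taylor_coeff F n = of_int (s n) / 2"
    and s0: "s 0 = 0" and s1: "s 1 = 2"
  obtains A B where "s 3 = A" "s 2 = B"
    "A = 2 \<and> \<bar>B\<bar> \<le> 2 \<or> A = 1 \<and> \<bar>B\<bar> \<le> 1 \<or> A = 0 \<and> B = 0"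
    "\<And>z. z \<in> unit_disc \<Longrightarrow> F z = z + (of_int B * z ^ 2 + of_int A * z ^ 3) / (2 * (1 - z ^ 2))"
proof -
  have "taylor_coeff F n \<in> \<real>" for n by (simp add: coeff)
  note sym = symmetric_of_real_coeffs[OF hol this]
  have "deriv F 0 = 1" using coeff[of 1] s1 by (simp add: taylor_coeff_def fps_expansion_def)
  note tr = typically_real_of_vertically_convex[OF hol inj conv sym this]
  define e where "e = (\<lambda>n. case n of 0 \<Rightarrow> 4 | Suc n \<Rightarrow> int (n + 2) * s (n + 2) - int n * s n)"
  define e' where "e' = (\<lambda>n. of_int (e n) / 2 :: real)"
  have c: "Re (fps_nth (fps_expansion F 0) n) = of_int (s n) / 2" for n
    using arg_cong[OF coeff[of n], of Re] by (simp add: taylor_coeff_def)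
  have "psd_toeplitz e'"
    by (rule psd_toeplitz_of_typically_real[OF hol tr])
       (use s1 in \<open>auto simp: c e'_def e_def algebra_simps add_divide_distrib diff_divide_distrib\<close>)
  from psd_toeplitz_scale[OF this, of 2] have "psd_toeplitz (\<lambda>n. of_int (e n))" by (simp add: e'_def)
  then obtain A B where AB: "\<And>n. odd n \<Longrightarrow> n \<ge> 3 \<Longrightarrow> s n = A" "\<And>n. even n \<Longrightarrow> n \<ge> 2 \<Longrightarrow> s n = B"
    "A = 2 \<and> \<bar>B\<bar> \<le> 2 \<or> A = 1 \<and> \<bar>B\<bar> \<le> 1 \<or> A = 0 \<and> B = 0"
    using half_integer_toeplitz_classification[of s e] s1 by (auto simp: e_def)
  have "F z = z + (of_int B * z ^ 2 + of_int A * z ^ 3) / (2 * (1 - z ^ 2))" if "z \<in> unit_disc" for z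
  proof -
    have "F z = z + (of_int B / 2 * z ^ 2 + of_int A / 2 * z ^ 3) / (1 - z ^ 2)"
      using that AB(1,2) s0 s1 by (intro eventually_periodic_power_series[OF hol]) (auto simp: coeff)
    also have "(of_int B / 2 * z ^ 2 + of_int A / 2 * z ^ 3) = (of_int B * z ^ 2 + of_int A * z ^ 3) / 2"
      by (simp add: add_divide_distrib)
    finally show ?thesis by (simp only: divide_divide_eq_left)
  qed
  thus thesis using AB by (intro that[of A B]) auto
qed

section \<open>Canonical representations and their dilatation\<close>

lemma real_valued_holomorphic_constant:
  assumes hol: "f holomorphic_on S" and S: "open S" "connected S"
    and real: "\<And>z. z \<in> S \<Longrightarrow> Im (f z) = 0" and z: "z \<in> S" and w: "w \<in> S"
  shows "f z = f w"
proof -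
  have "f constant_on S"
  proof (rule ccontr)
    assume "\<not> f constant_on S"
    from open_mapping_thm[OF hol S S(1) subset_refl this] have "open (f ` S)" .
    then obtain \<epsilon> where \<epsilon>: "\<epsilon> > 0" "ball (f z) \<epsilon> \<subseteq> f ` S" using z by (meson imageI open_contains_ball)
    have "f z + \<i> * of_real (\<epsilon> / 2) \<in> ball (f z) \<epsilon>" using \<epsilon>(1) by (simp add: dist_norm norm_mult)
    then obtain u where "u \<in> S" "f u = f z + \<i> * of_real (\<epsilon> / 2)" using \<epsilon>(2) by (metis imageE subsetD)
    thus False using real[of u] real[OF z] \<epsilon>(1) by simp
  qed
  thus ?thesis using z w by (auto simp: constant_on_def)
qed

text \<open>
  The difference of two representations is a holomorphic function \<open>\<phi>\<close> that equals the conjugate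
  of a holomorphic function \<open>\<psi>\<close>. Then \<open>\<phi> + \<psi>\<close> and \<open>\<i> (\<phi> - \<psi>)\<close> are real valued, hence
  constant.
\<close>

lemma canonical_rep_unique:
  assumes 1: "canonical_rep f h g" and 2: "canonical_rep f h' g'" and z: "z \<in> unit_disc"
  shows "h' z = h z" "g' z = g z"
proof -
  define \<phi> where "\<phi> = (\<lambda>z. h z - h' z)"
  define \<psi> where "\<psi> = (\<lambda>z. g' z - g z)"
  have hol: "\<phi> holomorphic_on unit_disc" "\<psi> holomorphic_on unit_disc"
    unfolding \<phi>_def \<psi>_def using 1 2 by (auto simp: canonical_rep_def intro!: holomorphic_intros)
  have eq: "\<phi> w = cnj (\<psi> w)" if "w \<in> unit_disc" for w
  proof -
    have "h w + cnj (g w) = h' w + cnj (g' w)" using 1 2 that unfolding canonical_rep_def by metis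
    thus ?thesis by (simp add: \<phi>_def \<psi>_def algebra_simps)
  qed
  have \<psi>0: "\<psi> 0 = 0" using 1 2 by (simp add: \<psi>_def canonical_rep_def)
  have "\<phi> z + \<psi> z = \<phi> 0 + \<psi> 0"
    by (rule real_valued_holomorphic_constant[of "\<lambda>z. \<phi> z + \<psi> z" unit_disc])
       (use hol z eq in \<open>auto intro!: holomorphic_intros\<close>)
  moreover have "\<i> * (\<phi> z - \<psi> z) = \<i> * (\<phi> 0 - \<psi> 0)"
    by (rule real_valued_holomorphic_constant[of "\<lambda>z. \<i> * (\<phi> z - \<psi> z)" unit_disc])
       (use hol z eq in \<open>auto intro!: holomorphic_intros\<close>)
  ultimately have "\<phi> z + \<psi> z = 0" "\<phi> z - \<psi> z = 0" using eq[of 0] \<psi>0 by auto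
  hence "\<phi> z = 0" "\<psi> z = 0" by (simp_all add: add_eq_0_iff)
  thus "h' z = h z" "g' z = g z" by (simp_all add: \<phi>_def \<psi>_def)
qed

text \<open>
  The dilatation \<open>\<omega> = g' / h'\<close> is bounded by \<open>1\<close>, hence so are its Taylor coefficients. As
  \<open>h'\<close> starts with \<open>1\<close>, the first nonzero coefficient of \<open>\<omega>\<close> is that of \<open>g'\<close>, namely
  \<open>(n + 1) b\<^sub>n\<^sub>+\<^sub>1\<close>, of modulus at least \<open>(n + 1) / 2\<close>. So \<open>n = 1\<close> and the modulus is exactly \<open>1\<close>,
  which is the equality case of the Schwarz lemma.
\<close>

lemma half_integer_dilatation:
  assumes holh: "h holomorphic_on unit_disc" and holg: "g holomorphic_on unit_disc"
    and dom: "\<And>z. z \<in> unit_disc \<Longrightarrow> norm (deriv g z) < norm (deriv h z)"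
    and g0: "g 0 = 0" and g'0: "deriv g 0 = 0" and h'0: "deriv h 0 = 1"
    and half: "\<And>n. 2 * taylor_coeff g n \<in> \<int>"
  obtains "\<And>z. z \<in> unit_disc \<Longrightarrow> g z = 0"
  | \<epsilon> :: int where "\<bar>\<epsilon>\<bar> = 1" "\<And>z. z \<in> unit_disc \<Longrightarrow> deriv g z = of_int \<epsilon> * z * deriv h z"
proof -
  define \<omega> where "\<omega> = (\<lambda>z. deriv g z / deriv h z)"
  define W where "W = fps_expansion \<omega> 0"
  define G where "G = fps_expansion g 0"
  define H where "H = fps_expansion h 0"
  have h'nz: "deriv h z \<noteq> 0" if "z \<in> unit_disc" for z using dom[OF that] by auto
  have hol\<omega>: "\<omega> holomorphic_on unit_disc"
    unfolding \<omega>_def using h'nz by (intro holomorphic_intros holomorphic_deriv holh holg) auto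
  have g'_eq: "deriv g z = \<omega> z * deriv h z" if "z \<in> unit_disc" for z
    using h'nz[OF that] by (simp add: \<omega>_def)
  have \<omega>_less: "norm (\<omega> z) < 1" if "z \<in> unit_disc" for z
    using dom[OF that] h'nz[OF that] by (simp add: \<omega>_def norm_divide)
  have \<omega>0: "\<omega> 0 = 0" using g'0 by (simp add: \<omega>_def)
  have HG: "h has_fps_expansion H" "g has_fps_expansion G" "\<omega> has_fps_expansion W"
    unfolding H_def G_def W_def using holh holg hol\<omega> by (auto intro!: has_fps_expansion_fps_expansion[of unit_disc])
  have prod: "(\<lambda>z. \<omega> z * deriv h z) has_fps_expansion W * fps_deriv H"
    using HG by (intro has_fps_expansion_mult has_fps_expansion_deriv)
  have near: "\<forall>\<^sub>F z in nhds 0. \<omega> z * deriv h z = deriv g z"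
    using g'_eq eventually_nhds_in_open[of unit_disc 0] by (auto elim!: eventually_mono)
  have "deriv g has_fps_expansion W * fps_deriv H"
    using prod has_fps_expansion_cong[OF near refl] by blast
  hence G': "fps_deriv G = W * fps_deriv H"
    using has_fps_expansion_deriv[OF HG(2)] fps_expansion_unique_complex by blast
  have H1: "fps_nth (fps_deriv H) 0 = 1" using h'0 by (simp add: H_def fps_expansion_def)
  hence sub: "subdegree (fps_deriv H) = 0" by (intro subdegreeI) auto
  have coeff: "fps_nth W n = of_nat (n + 1) * taylor_coeff g (n + 1)" if "n = subdegree W" for n
  proof -
    have "fps_nth (fps_deriv G) n = fps_nth W n"
      using nth_subdegree_mult[of W "fps_deriv H"] that sub H1 by (simp add: G')
    thus ?thesis by (simp add: taylor_coeff_def G_def)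
  qed
  show thesis
  proof (cases "W = 0")
    case True
    hence "fps_nth (fps_deriv G) n = 0" for n by (simp add: G')
    hence "of_nat (Suc n) * fps_nth G (Suc n) = 0" for n by (simp only: fps_deriv_nth Suc_eq_plus1)
    hence "taylor_coeff g (Suc n) = 0" for n
      unfolding taylor_coeff_def G_def by (metis mult_eq_0_iff of_nat_neq_0)
    hence "taylor_coeff g n = 0" for n using g0 by (cases n) (auto simp: taylor_coeff_0)
    hence "g z = 0" if "z \<in> unit_disc" for z
      using taylor_sums[OF holg that] sums_unique2[OF _ sums_zero] by simp
    thus thesis by (rule that(1))
  next
    case False
    define n where "n = subdegree W"
    have "fps_nth W 0 = 0" using \<omega>0 by (simp add: W_def fps_expansion_def)
    hence n0: "n > 0" using False nth_subdegree_nonzero[of W] unfolding n_def by (metis gr0I)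
    obtain k where k: "2 * taylor_coeff g (n + 1) = of_int k" using half Ints_cases by blast
    have Wn: "fps_nth W n = of_real (real (n + 1) * of_int k / 2)"
      using coeff[of n] k by (simp add: n_def field_simps)
    have "k \<noteq> 0" using Wn False nth_subdegree_nonzero[of W] by (auto simp: n_def)
    hence k1: "1 \<le> \<bar>k\<bar>" by linarith
    have "norm (fps_nth W n) \<le> 1"
      using taylor_coeff_norm_le[OF hol\<omega> less_imp_le[OF \<omega>_less]] by (simp add: W_def taylor_coeff_def)
    hence "real (n + 1) * \<bar>of_int k\<bar> \<le> 2" unfolding Wn by (simp only: norm_of_real abs_mult abs_divide)
    hence "real_of_int (int (n + 1) * \<bar>k\<bar>) \<le> real_of_int 2" by simp
    hence le: "int (n + 1) * \<bar>k\<bar> \<le> 2" by linarith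
    have "int (n + 1) * 1 \<le> int (n + 1) * \<bar>k\<bar>" using k1 by (intro mult_left_mono) auto
    also note le
    finally have n1: "n = 1" using n0 by simp
    hence k_abs: "\<bar>k\<bar> = 1" using le k1 by simp
    have d\<omega>: "deriv \<omega> 0 = of_int k" using Wn n1 by (simp add: W_def fps_expansion_def)
    hence "norm (deriv \<omega> 0) = 1" using k_abs by simp
    then obtain \<alpha> where \<alpha>: "\<forall>z. norm z < 1 \<longrightarrow> \<omega> z = \<alpha> * z"
      using Schwarz_Lemma(3)[OF hol\<omega> \<omega>0 _ , of 0] \<omega>_less by auto
    have "(\<omega> has_field_derivative \<alpha>) (at 0)"
      by (rule has_field_derivative_transform_within_open[of "\<lambda>z. \<alpha> * z" _ _ unit_disc])
         (use \<alpha> in \<open>auto intro!: derivative_eq_intros\<close>)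
    hence "\<alpha> = of_int k" using d\<omega> DERIV_imp_deriv by metis
    thus thesis using that(2)[OF k_abs] g'_eq \<alpha> by simp
  qed
qed
section \<open>The eleven functions\<close>

text \<open>
  The derivatives of \<open>h\<close> and \<open>g\<close> are determined by their sum and their quotient
  \<open>\<epsilon> z\<close>: one gets \<open>h' = 1 / (1 + \<epsilon> z)\<^sup>3\<close>, and \<open>h' - g' = (1 - \<epsilon> z) / (1 + \<epsilon> z)\<^sup>3\<close> is the
  derivative of a rotated Koebe function.
\<close>

lemma shear_of_half_plane_map:
  fixes \<epsilon> :: int
  assumes holh: "h holomorphic_on unit_disc" and holg: "g holomorphic_on unit_disc"
    and h0: "h 0 = 0" and g0: "g 0 = 0" and \<epsilon>: "\<bar>\<epsilon>\<bar> = 1"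
    and dil: "\<And>z. z \<in> unit_disc \<Longrightarrow> deriv g z = of_int \<epsilon> * z * deriv h z"
    and sum: "\<And>z. z \<in> unit_disc \<Longrightarrow> h z + g z = z / (1 + of_int \<epsilon> * z)"
    and z: "z \<in> unit_disc"
  shows "h z - g z = z / (1 + of_int \<epsilon> * z)\<^sup>2"
proof -
  define e where "e = (of_int \<epsilon> :: complex)"
  have e: "norm e = 1" using \<epsilon> by (simp add: e_def flip: of_int_abs)
  have nz: "1 + e * w \<noteq> 0" if "w \<in> unit_disc" for w
  proof
    assume "1 + e * w = 0"
    hence "e * w = -1" by (simp add: add_eq_0_iff)
    hence "norm e * norm w = 1" by (metis norm_minus_cancel norm_mult norm_one)
    thus False using that e by simp
  qed
  have dh: "(h has_field_derivative deriv h w) (at w)" and dg: "(g has_field_derivative deriv g w) (at w)"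
    if "w \<in> unit_disc" for w using holh holg that by (auto intro: holomorphic_derivI)
  have h': "deriv h w = 1 / (1 + e * w) ^ 3" if w: "w \<in> unit_disc" for w
  proof -
    have "((\<lambda>w. h w + g w) has_field_derivative 1 / (1 + e * w)\<^sup>2) (at w)"
    proof (rule has_field_derivative_transform_within_open[of "\<lambda>w. w / (1 + e * w)" _ _ unit_disc])
      show "((\<lambda>w. w / (1 + e * w)) has_field_derivative 1 / (1 + e * w)\<^sup>2) (at w)"
        using nz[OF w] by (auto intro!: derivative_eq_intros simp: power2_eq_square field_simps)
    qed (use w sum in \<open>auto simp: e_def\<close>)
    moreover have "((\<lambda>w. h w + g w) has_field_derivative deriv h w + deriv g w) (at w)"
      using dh[OF w] dg[OF w] by (rule DERIV_add)
    ultimately have "deriv h w + deriv g w = 1 / (1 + e * w)\<^sup>2" using DERIV_unique by blast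
    hence "deriv h w * (1 + e * w) = 1 / (1 + e * w)\<^sup>2"
      using dil[OF w] by (simp add: e_def algebra_simps)
    hence "deriv h w = 1 / (1 + e * w)\<^sup>2 / (1 + e * w)"
      using nz[OF w] by (metis nonzero_mult_div_cancel_right)
    thus ?thesis by (simp add: power3_eq_cube power2_eq_square mult_ac)
  qed
  have "((\<lambda>w. h w - g w - w / (1 + e * w)\<^sup>2) has_field_derivative 0) (at w within unit_disc)"
    if w: "w \<in> unit_disc" for w
  proof -
    have "((\<lambda>w. w / (1 + e * w)\<^sup>2) has_field_derivative (1 - e * w) / (1 + e * w) ^ 3) (at w)"
      using nz[OF w] by (auto intro!: derivative_eq_intros simp: divide_simps eval_nat_numeral) (simp add: algebra_simps)
    moreover have "deriv h w - deriv g w = (1 - e * w) / (1 + e * w) ^ 3"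
      using dil[OF w] h'[OF w] by (simp add: e_def diff_divide_distrib)
    ultimately have "((\<lambda>w. h w - g w - w / (1 + e * w)\<^sup>2) has_field_derivative 0) (at w)"
      using DERIV_diff[OF DERIV_diff[OF dh[OF w] dg[OF w]]] by fastforce
    thus ?thesis by (rule has_field_derivative_at_within)
  qed
  from has_field_derivative_zero_constant[OF convex_ball this]
  obtain c where c: "\<And>w. w \<in> unit_disc \<Longrightarrow> h w - g w - w / (1 + e * w)\<^sup>2 = c" by blast
  from c[of 0] c[OF z] h0 g0 show ?thesis by (simp add: e_def)
qed

text \<open>
  The last two denominators are the form in which the simplifier expands \<open>2 (1 \<plusminus> z)\<close>.
\<close>

lemma unit_disc_denominators:
  assumes "z \<in> unit_disc"
  shows "1 + z \<noteq> 0" "1 - z \<noteq> 0" "2 + z * 2 \<noteq> 0" "2 - z * 2 \<noteq> 0"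
proof -
  show 1: "1 + z \<noteq> 0" "1 - z \<noteq> 0" using assms by (auto simp: add_eq_0_iff)
  have "2 + z * 2 = 2 * (1 + z)" "2 - z * 2 = 2 * (1 - z)" by (simp_all add: algebra_simps)
  thus "2 + z * 2 \<noteq> 0" "2 - z * 2 \<noteq> 0" using 1 by (metis mult_eq_0_iff zero_neq_numeral)+
qed

lemma T5_cases:
  assumes AB: "A = 2 \<and> \<bar>B\<bar> \<le> 2 \<or> A = 1 \<and> \<bar>B\<bar> \<le> 1 \<or> A = 0 \<and> B = (0::int)"
    and f: "\<And>z. z \<in> unit_disc \<Longrightarrow> f z = z + (of_int B * z ^ 2 + of_int A * z ^ 3) / (2 * (1 - z ^ 2))"
  shows "\<exists>F\<in>T5. \<forall>z\<in>unit_disc. f z = F z"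
proof -
  note nz = unit_disc_denominators
  have fac: "1 - z\<^sup>2 = (1 - z) * (1 + z)" for z :: complex by (simp add: algebra_simps power2_eq_square)
  have "A = 2 \<and> (B = 2 \<or> B = 1 \<or> B = 0 \<or> B = -1 \<or> B = -2) \<or>
      A = 1 \<and> (B = 1 \<or> B = 0 \<or> B = -1) \<or> A = 0 \<and> B = 0"
    using AB unfolding abs_le_iff by presburger
  then consider "A = 2" "B = 2" | "A = 2" "B = 1" | "A = 2" "B = 0" | "A = 2" "B = -1" | "A = 2" "B = -2"
    | "A = 1" "B = 1" | "A = 1" "B = 0" | "A = 1" "B = -1" | "A = 0" "B = 0"
    by blast
  thus ?thesis
  proof cases
    case 1
    have "f z = z / (1 - z)" if "z \<in> unit_disc" for z
      unfolding f[OF that] 1 fac using nz[OF that] by (simp add: divide_simps) (simp add: algebra_simps eval_nat_numeral)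
    thus ?thesis by (intro bexI[of _ "\<lambda>z. z / (1 - z)"]) (auto simp: T5_def)
  next
    case 2
    have "f z = z * (2 + z) / (2 * (1 - z\<^sup>2))" if "z \<in> unit_disc" for z
      unfolding f[OF that] 2 fac using nz[OF that] by (simp add: divide_simps) (simp add: algebra_simps eval_nat_numeral)
    thus ?thesis by (intro bexI[of _ "\<lambda>z. z * (2 + z) / (2 * (1 - z\<^sup>2))"]) (auto simp: T5_def)
  next
    case 3
    have "f z = z / (1 - z\<^sup>2)" if "z \<in> unit_disc" for z
      unfolding f[OF that] 3 fac using nz[OF that] by (simp add: divide_simps) (simp add: algebra_simps eval_nat_numeral)
    thus ?thesis by (intro bexI[of _ "\<lambda>z. z / (1 - z\<^sup>2)"]) (auto simp: T5_def)
  next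
    case 4
    have "f z = z * (2 - z) / (2 * (1 - z\<^sup>2))" if "z \<in> unit_disc" for z
      unfolding f[OF that] 4 fac using nz[OF that] by (simp add: divide_simps) (simp add: algebra_simps eval_nat_numeral)
    thus ?thesis by (intro bexI[of _ "\<lambda>z. z * (2 - z) / (2 * (1 - z\<^sup>2))"]) (auto simp: T5_def)
  next
    case 5
    have "f z = z / (1 + z)" if "z \<in> unit_disc" for z
      unfolding f[OF that] 5 fac using nz[OF that] by (simp add: divide_simps) (simp add: algebra_simps eval_nat_numeral)
    thus ?thesis by (intro bexI[of _ "\<lambda>z. z / (1 + z)"]) (auto simp: T5_def)
  next
    case 6
    have "f z = z * (2 - z) / (2 * (1 - z))" if "z \<in> unit_disc" for z
      unfolding f[OF that] 6 fac using nz[OF that] by (simp add: divide_simps) (simp add: algebra_simps eval_nat_numeral)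
    thus ?thesis by (intro bexI[of _ "\<lambda>z. z * (2 - z) / (2 * (1 - z))"]) (auto simp: T5_def)
  next
    case 7
    have "f z = z * (2 - z\<^sup>2) / (2 * (1 - z\<^sup>2))" if "z \<in> unit_disc" for z
      unfolding f[OF that] 7 fac using nz[OF that] by (simp add: divide_simps) (simp add: algebra_simps eval_nat_numeral)
    thus ?thesis by (intro bexI[of _ "\<lambda>z. z * (2 - z\<^sup>2) / (2 * (1 - z\<^sup>2))"]) (auto simp: T5_def)
  next
    case 8
    have "f z = z * (2 + z) / (2 * (1 + z))" if "z \<in> unit_disc" for z
      unfolding f[OF that] 8 fac using nz[OF that] by (simp add: divide_simps) (simp add: algebra_simps eval_nat_numeral)
    thus ?thesis by (intro bexI[of _ "\<lambda>z. z * (2 + z) / (2 * (1 + z))"]) (auto simp: T5_def)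
  next
    case 9
    have "f z = z" if "z \<in> unit_disc" for z using f[OF that] 9 by simp
    thus ?thesis by (intro bexI[of _ "\<lambda>z. z"]) (auto simp: T5_def)
  qed
qed

theorem theorem4:
  fixes f :: "complex \<Rightarrow> complex"
  assumes "f \<in> S_H0_half"
    and "convex_imaginary_direction f"
  shows "\<exists>F \<in> T5 \<union> T6. \<forall>z\<in>unit_disc. f z = F z"
proof -
  obtain h g where injf: "inj_on f unit_disc" and rep: "canonical_rep f h g"
    and t0: "taylor_coeff h 0 = 0" and t1: "taylor_coeff h 1 = 1"
    and jac: "\<And>z. z \<in> unit_disc \<Longrightarrow> jacobian h g z > 0"
    using assms(1) unfolding S_H0_half_def S_H0_def S_H_def by blast
  obtain h2 g2 where rep2: "canonical_rep f h2 g2" and g2: "deriv g2 0 = 0"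
    using assms(1) unfolding S_H0_half_def S_H0_def by blast
  obtain h3 g3 where rep3: "canonical_rep f h3 g3"
    and half3: "\<And>n. 2 * taylor_coeff h3 n \<in> \<int>" "\<And>n. 2 * taylor_coeff g3 n \<in> \<int>"
    using assms(1) unfolding S_H0_half_def half_integer_coeffs_def by blast
  have holh: "h holomorphic_on unit_disc" and holg: "g holomorphic_on unit_disc" and g0: "g 0 = 0"
    and f_eq: "\<And>z. z \<in> unit_disc \<Longrightarrow> f z = h z + cnj (g z)"
    using rep by (auto simp: canonical_rep_def)
  \<comment> \<open>The three parts of the assumption on \<open>f\<close> speak of a priori different
    representations; uniqueness transfers them to \<open>h\<close> and \<open>g\<close>.\<close>
  have halfh: "2 * taylor_coeff h n \<in> \<int>" and halfg: "2 * taylor_coeff g n \<in> \<int>" for n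
    using half3[of n] taylor_coeff_cong[of h3 h n] taylor_coeff_cong[of g3 g n]
      canonical_rep_unique[OF rep rep3] by auto
  have "taylor_coeff g2 1 = taylor_coeff g 1"
    by (rule taylor_coeff_cong) (rule canonical_rep_unique(2)[OF rep rep2])
  hence g'0: "deriv g 0 = 0" using g2 by (simp only: taylor_coeff_1)
  have h0: "h 0 = 0" and h'0: "deriv h 0 = 1"
    using t0 t1 by (simp_all only: taylor_coeff_0 taylor_coeff_1)
  have dom: "norm (deriv g z) < norm (deriv h z)" if "z \<in> unit_disc" for z
    using jac[OF that] by (auto simp: jacobian_def intro: power2_less_imp_less)
  define F where "F = (\<lambda>z. h z + g z)"
  have holF: "F holomorphic_on unit_disc" unfolding F_def by (intro holomorphic_intros holh holg)
  have F': "deriv F z \<noteq> 0" if "z \<in> unit_disc" for z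
  proof
    assume "deriv F z = 0"
    moreover have "deriv F z = deriv h z + deriv g z" unfolding F_def
      using holh holg that by (intro deriv_add holomorphic_on_imp_differentiable_at[of _ unit_disc]) auto
    ultimately have "norm (deriv h z) = norm (deriv g z)" by (metis add_eq_0_iff norm_minus_cancel)
    thus False using dom[OF that] by simp
  qed
  have contf: "continuous_on unit_disc f"
  proof -
    have "continuous_on unit_disc (\<lambda>z. h z + cnj (g z))"
      by (intro continuous_intros holomorphic_on_imp_continuous_on holh holg)
    thus ?thesis by (rule continuous_on_eq) (simp add: f_eq)
  qed
  have convf: "connected ({w. Re w = x} \<inter> f ` unit_disc)" for x
    using assms(2) by (simp add: convex_imaginary_direction_def)
  have Re_eq: "Re (F z) = Re (f z)" if "z \<in> unit_disc" for z using f_eq[OF that] by (simp add: F_def)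
  note shear = shear_univalent_and_vertically_convex[OF open_ball contf injf convf holF F' Re_eq]
  have "\<exists>k. 2 * taylor_coeff h n = of_int k" for n using halfh[of n] by (auto elim: Ints_cases)
  then obtain \<alpha> where \<alpha>: "2 * taylor_coeff h n = of_int (\<alpha> n)" for n by metis
  have "\<exists>k. 2 * taylor_coeff g n = of_int k" for n using halfg[of n] by (auto elim: Ints_cases)
  then obtain \<beta> where \<beta>: "2 * taylor_coeff g n = of_int (\<beta> n)" for n by metis
  have coeffF: "taylor_coeff F n = of_int (\<alpha> n + \<beta> n) / 2" for n
    using \<alpha>[of n] \<beta>[of n] unfolding F_def taylor_coeff_add[OF holh holg] by (simp flip: \<alpha> \<beta>)
  have init: "\<alpha> 0 = 0" "\<alpha> 1 = 2" "\<beta> 0 = 0" "\<beta> 1 = 0"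
    using \<alpha>[of 0] \<alpha>[of 1] \<beta>[of 0] \<beta>[of 1] t0 t1 g0 g'0 by (simp_all add: taylor_coeff_0 taylor_coeff_1[unfolded One_nat_def])
  obtain A B where AB: "\<alpha> 3 + \<beta> 3 = A" "\<alpha> 2 + \<beta> 2 = B"
    "A = 2 \<and> \<bar>B\<bar> \<le> 2 \<or> A = 1 \<and> \<bar>B\<bar> \<le> 1 \<or> A = 0 \<and> B = 0"
    and F_eq: "\<And>z. z \<in> unit_disc \<Longrightarrow> F z = z + (of_int B * z ^ 2 + of_int A * z ^ 3) / (2 * (1 - z ^ 2))"
    using vertically_convex_half_integer_classification[OF holF shear coeffF] init by auto
  from holh holg dom g0 g'0 h'0 halfg show ?thesis
  proof (rule half_integer_dilatation)
    assume "\<And>z. z \<in> unit_disc \<Longrightarrow> g z = 0"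
    hence "f z = F z" if "z \<in> unit_disc" for z using f_eq that by (simp add: F_def)
    hence "\<exists>F\<in>T5. \<forall>z\<in>unit_disc. f z = F z" using F_eq by (intro T5_cases[OF AB(3)]) simp
    thus ?thesis by blast
  next
    fix \<epsilon> :: int
    assume \<epsilon>: "\<bar>\<epsilon>\<bar> = 1" and dil: "\<And>z. z \<in> unit_disc \<Longrightarrow> deriv g z = of_int \<epsilon> * z * deriv h z"
    \<comment> \<open>The coefficients of \<open>g' = \<epsilon> z h'\<close>, with \<open>\<alpha>\<close> and \<open>\<beta>\<close> twice those of \<open>h\<close> and
      \<open>g\<close>.\<close>
    have rec: "int (n + 2) * \<beta> (n + 2) = \<epsilon> * int (n + 1) * \<alpha> (n + 1)" for n
    proof -
      have dh: "deriv h has_fps_expansion fps_deriv (fps_expansion h 0)"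
        and dg: "deriv g has_fps_expansion fps_deriv (fps_expansion g 0)"
        using holh holg by (auto intro!: has_fps_expansion_deriv has_fps_expansion_fps_expansion[of unit_disc])
      have prod: "(\<lambda>z. of_int \<epsilon> * (z * deriv h z)) has_fps_expansion
          fps_const (of_int \<epsilon>) * (fps_X * fps_deriv (fps_expansion h 0))"
        by (intro has_fps_expansion_cmult_left has_fps_expansion_mult has_fps_expansion_fps_X dh)
      have near: "\<forall>\<^sub>F z in nhds 0. of_int \<epsilon> * (z * deriv h z) = deriv g z"
        using dil eventually_nhds_in_open[of unit_disc 0] by (auto elim!: eventually_mono)
      have "deriv g has_fps_expansion fps_const (of_int \<epsilon>) * (fps_X * fps_deriv (fps_expansion h 0))"
        using prod has_fps_expansion_cong[OF near refl] by blast
      with dg have "fps_deriv (fps_expansion g 0) =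
          fps_const (of_int \<epsilon>) * (fps_X * fps_deriv (fps_expansion h 0))"
        by (rule fps_expansion_unique_complex)
      from arg_cong[OF this, of "\<lambda>X. 2 * fps_nth X (n + 1)"]
      have "of_nat (n + 2) * (2 * taylor_coeff g (n + 2)) =
          of_int \<epsilon> * of_nat (n + 1) * (2 * taylor_coeff h (n + 1))"
        by (simp add: taylor_coeff_def algebra_simps)
      hence "complex_of_int (int (n + 2) * \<beta> (n + 2)) = of_int (\<epsilon> * int (n + 1) * \<alpha> (n + 1))"
        unfolding \<alpha> \<beta> by simp
      thus ?thesis by (simp only: of_int_eq_iff)
    qed
    have r2: "2 * \<beta> 2 = \<epsilon> * 2" and r3: "3 * \<beta> 3 = 2 * \<epsilon> * \<alpha> 2" and r4: "4 * \<beta> 4 = 3 * \<epsilon> * \<alpha> 3"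
      using rec[of 0] rec[of 1] rec[of 2] init by (simp_all add: eval_nat_numeral)
    \<comment> \<open>By \<open>r2\<close> and \<open>r3\<close>, 3 divides \<open>\<alpha> 2 = B - \<epsilon>\<close>, which leaves \<open>B = -2 \<epsilon>\<close> and
      \<open>B = \<epsilon>\<close>. In the latter case \<open>\<alpha> 2 = \<beta> 3 = 0\<close>, so \<open>A = \<alpha> 3 \<in> {1, 2}\<close>, although 4
      divides \<open>\<alpha> 3\<close> by \<open>r4\<close>.\<close>
    have "\<epsilon> = 1 \<or> \<epsilon> = -1" using \<epsilon> by linarith
    hence "A = 2 \<and> B = -2 * \<epsilon>"
    proof
      assume "\<epsilon> = 1"
      thus ?thesis using r2 r3 r4 AB by simp presburger
    next
      assume "\<epsilon> = -1"
      thus ?thesis using r2 r3 r4 AB by simp presburger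
    qed
    hence sum: "h z + g z = z / (1 + of_int \<epsilon> * z)" if z: "z \<in> unit_disc" for z
    proof -
      note nz = unit_disc_denominators[OF z]
      have fac: "1 - z\<^sup>2 = (1 - z) * (1 + z)" by (simp add: algebra_simps power2_eq_square)
      have "F z = z / (1 + of_int \<epsilon> * z)"
        using \<open>\<epsilon> = 1 \<or> \<epsilon> = -1\<close>
      proof
        assume "\<epsilon> = 1"
        thus ?thesis unfolding F_eq[OF z] fac using nz \<open>A = 2 \<and> B = -2 * \<epsilon>\<close>
          by (simp add: divide_simps) (simp add: algebra_simps eval_nat_numeral)
      next
        assume "\<epsilon> = -1"
        thus ?thesis unfolding F_eq[OF z] fac using nz \<open>A = 2 \<and> B = -2 * \<epsilon>\<close>
          by (simp add: divide_simps) (simp add: algebra_simps eval_nat_numeral)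
      qed
      thus ?thesis by (simp add: F_def)
    qed
    have diff: "h z - g z = z / (1 + of_int \<epsilon> * z)\<^sup>2" if "z \<in> unit_disc" for z
      using holh holg h0 g0 \<epsilon> dil sum that by (rule shear_of_half_plane_map)
    have f_form: "f z = of_real (Re (z / (1 + of_int \<epsilon> * z))) + \<i> * of_real (Im (z / (1 + of_int \<epsilon> * z)\<^sup>2))"
      if "z \<in> unit_disc" for z
      unfolding sum[OF that, symmetric] diff[OF that, symmetric] f_eq[OF that] by (simp add: complex_eq_iff)
    show ?thesis using \<open>\<epsilon> = 1 \<or> \<epsilon> = -1\<close>
    proof
      assume "\<epsilon> = 1"
      thus ?thesis using f_form
        by (intro bexI[of _ "\<lambda>z. of_real (Re (z / (1 + z))) + \<i> * of_real (Im (z / (1 + z)\<^sup>2))"]) (auto simp: T6_def)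
    next
      assume "\<epsilon> = -1"
      thus ?thesis using f_form
        by (intro bexI[of _ "\<lambda>z. of_real (Re (z / (1 - z))) + \<i> * of_real (Im (z / (1 - z)\<^sup>2))"]) (auto simp: T6_def)
    qed
  qed
qed

end
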